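(* Let $n\in\mathbb{N}$, let $\widetilde\sigma$ be an element of $\mathfrak{M}(n,\infty)$, let $\{\widetilde{\boldsymbol{p}}_k\}_{k=1}^\infty$ and $\{\widetilde{\boldsymbol{q}}_j\}_{j=1}^{j_0}$ be the sequences of vector polynomials obtained from $\widetilde\sigma$ by the Gram–Schmidt procedure, and let $c_{ik}$ be the coefficients in the expansions $$z\widetilde{\boldsymbol{p}}_k(z)=\sum_{i=1}^{l}c_{ik}\widetilde{\boldsymbol{p}}_i(z)+\sum_{j=1}^{j_0}R_{kj}(z)\widetilde{\boldsymbol{q}}_j(z),\qquad k\in\mathbb{N}$$ ($R_{kj}$ scalar polynomials, $l=l(k)$). Then $\widetilde\sigma$ is a spectral function of the matrix $\{c_{kl}\}_{k,l=1}^\infty$.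
   Context: **The class $\mathcal{M}(n,\infty)$.** It consists of the infinite real symmetric matrices $\mathcal{A}=(a_{kl})_{k,l\ge1}$ with $a_{kl}=0$ for $|k-l|>n$ such that, writing $d_k^{(i)}:=a_{k,k+i}=a_{k+i,k}$ ($0\le i\le n$, $k\ge 1$), there are an integer $0\le j_0\le n-1$ and integers $m_1<m_2<\dots<m_{j_0}$, with $m_1>1$ and $m_j+1<m_{j+1}$ for $1\le j\le j_0-1$, having the following property. Put $m_0:=0$ and $m_{j_0+1}:=\infty$. For every $j\in\{0,\dots,j_0\}$: $d_k^{(n-j)}>0$ for all $k$ with $m_j<k<m_{j+1}$, and $d_k^{(n-j)}=0$ for all $k\ge m_{j+1}$ (void for $j=j_0$). **Vector polynomials attached to a matrix.** An $n$-dimensional vector polynomial is $\boldsymbol{r}(z)=(R_1(z),\dots,R_n(z))^t$ with scalar polynomial entries. Its height is $h(\boldsymbol{r}):=\max_{1\le j\le n}\{n\deg R_j+j-1\}$, with $\deg 0:=-\infty$. Let $\mathscr{T}$ be an $n\times n$ upper triangular matrix with real entries and nonzero diagonal entries. Given $\mathcal{A}\in\mathcal{M}(n,\infty)$ and $\mathscr{T}$, put $\boldsymbol{p}_k:=\mathscr{T}\boldsymbol{e}_k$ for $k=1,\dots,n$ ($\boldsymbol{e}_1,\dots,\boldsymbol{e}_n$ the canonical basis of $\mathbb{C}^n$) and $\boldsymbol{p}_k:=0$ for $k<1$; for $k>n$ the vector polynomials $\boldsymbol{p}_k(z)$ are determined by the recurrence $$\sum_{i=0}^{n-1} d_{k-n+i}^{(n-i)}\boldsymbol{p}_{k-n+i}(z)+d_k^{(0)}\boldsymbol{p}_k(z)+\sum_{i=1}^n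 d_k^{(i)}\boldsymbol{p}_{k+i}(z)=z\,\boldsymbol{p}_k(z),\qquad k\in\mathbb{N}\setminus\{m_1,\dots,m_{j_0}\}$$ (terms with index less than $1$ are zero). For $j=1,\dots,j_0$ put $$\boldsymbol{q}_j(z):=(z-d_{m_j}^{(0)})\boldsymbol{p}_{m_j}(z)-\sum_{k=0}^{n-1}d_{m_j-n+k}^{(n-k)}\boldsymbol{p}_{m_j-n+k}(z)-\sum_{k=1}^{n-j}d_{m_j}^{(k)}\boldsymbol{p}_{m_j+k}(z).$$ **Spectral function.** For a nondecreasing $n\times n$ matrix-valued function $\sigma$ on $\mathbb{R}$, $L_2(\mathbb{R},\sigma)$ is the usual Hilbert space of (classes of) $\mathbb{C}^n$-valued functions with inner product $\langle f,g\rangle=\int_{\mathbb{R}}\langle f(t),d\sigma(t)g(t)\rangle_{\mathbb{C}^n}$, antilinear in the first argument. A nondecreasing $n\times n$ matrix-valued function $\sigma$ with finite moments and $\int_{\mathbb{R}}d\sigma$ invertible is called a spectral function of a matrix $\mathcal{A}$ in $\mathcal{M}(n,\infty)$ if and only if there exists an $n\times n$ upper triangular matrix $\mathscr{T}$ with real entries and nonzero diagonal entries such that, for the vector polynomials $\boldsymbol{p}_k$, $\boldsymbol{q}_j$ determined by $\mathcal{A}$ and $\mathscr{T}$, $\{\boldsymbol{p}_k\}_{k=1}^\infty$ is an orthonormal sequence in $L_2(\mathbb{R},\sigma)$ and, for each $j\in\{1,\dots,j_0\}$, $\boldsymbol{q}_j$ is in the equivalence class of zero in $L_2(\mathbb{R},\sigma)$.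 **The class $\mathfrak{M}(n,\infty)$.** It is the set of all nondecreasing $n\times n$ matrix-valued functions on $\mathbb{R}$ with an infinite number of growth points such that all the moments $S_k=\int_{\mathbb{R}}t^k\,d\sigma$ ($k\ge 0$) exist and $S_0$ is invertible. **Gram–Schmidt procedure.** Put $\boldsymbol{e}_{nk+i}(z):=z^k\boldsymbol{e}_i$ for $k\ge0$, $1\le i\le n$ (so $h(\boldsymbol{e}_k)=k-1$). Given $\widetilde\sigma\in\mathfrak{M}(n,\infty)$, process $\boldsymbol{e}_1,\boldsymbol{e}_2,\dots$ in order, building a list $\widetilde{\boldsymbol{p}}_1,\widetilde{\boldsymbol{p}}_2,\dots$ of orthonormal vector polynomials and a list $\widetilde{\boldsymbol{q}}_1,\widetilde{\boldsymbol{q}}_2,\dots$ of vector polynomials of zero norm. At step $k$: if $k-1=h(\widetilde{\boldsymbol{q}}_i)+nl$ for some already constructed $\widetilde{\boldsymbol{q}}_i$ and some $l\in\mathbb{N}$, skip $\boldsymbol{e}_k$. Otherwise put $\widehat{\boldsymbol{p}}_k:=\boldsymbol{e}_k-\sum_i\langle\widetilde{\boldsymbol{p}}_i,\boldsymbol{e}_k\rangle\widetilde{\boldsymbol{p}}_i$, the sum over all $\widetilde{\boldsymbol{p}}_i$ constructed so far (inner product and norm of $L_2(\mathbb{R},\widetilde\sigma)$); if $\|\widehat{\boldsymbol{p}}_k\|=0$, the next $\widetilde{\boldsymbol{q}}_j$ is $\widehat{\boldsymbol{p}}_k$; otherwise the next $\widetilde{\boldsymbol{p}}_i$ is $\widehat{\boldsymbol{p}}_k/\|\widehat{\boldsymbol{p}}_k\|$.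 The procedure yields infinitely many $\widetilde{\boldsymbol{p}}_i$ and a number $j_0\le n-1$ of $\widetilde{\boldsymbol{q}}_j$; every vector polynomial is a finite linear combination of the $\widetilde{\boldsymbol{p}}_k$ and the $z^l\widetilde{\boldsymbol{q}}_j$ ($l\ge0$), which gives the expansions in the claim, and $c_{lk}=\langle\widetilde{\boldsymbol{p}}_l,z\widetilde{\boldsymbol{p}}_k\rangle_{L_2(\mathbb{R},\widetilde\sigma)}$.
   Formalization: As stated the matrix need not satisfy m_1>1 and m_j+1<m_{j+1}; proved with indices only required to satisfy 1≤m_1<m_2<…, and with those inequalities exactly when the Gram–Schmidt run satisfies the matching separation condition. Matrix functions are taken real symmetric. *)

theory Defs
  imports "HOL-Analysis.Analysis" "HOL-Computational_Algebra.Polynomial"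
begin

text \<open>
  The dimension n is \<open>CARD('n)\<close>.  The indices 1, ..., n are the elements of \<open>'n\<close> in increasing
  order; \<open>pos i\<close> is the index minus one, so it ranges over 0, ..., n - 1.
  Sequences and infinite matrices are functions on \<open>nat\<close> indexed from 1; values at index 0 are
  irrelevant unless a comment says otherwise.
\<close>

definition pos :: "'n::{finite,wellorder} \<Rightarrow> nat" where
  "pos i = card {j. j < i}"


section \<open>Nondecreasing matrix-valued functions and the space L2\<close>

text \<open>
  Matrix-valued functions are real symmetric.  Hermitian complex values have to be excluded: a
  spectral function satisfies \<open>T\<^sup>t S\<^sub>0 T = 1\<close> with a real matrix T, so \<open>S\<^sub>0\<close> is real.
\<close>

type_synonym 'n matfun = "real \<Rightarrow> real^'n^'n"

definition nonneg_matrix :: "real^'n^'n \<Rightarrow> bool" where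
  "nonneg_matrix M \<longleftrightarrow> transpose M = M \<and> (\<forall>x. 0 \<le> x \<bullet> (M *v x))"

definition nondecreasing_matrix :: "('n::finite) matfun \<Rightarrow> bool" where
  "nondecreasing_matrix \<sigma> \<longleftrightarrow>
     (\<forall>t. transpose (\<sigma> t) = \<sigma> t) \<and> (\<forall>s t. s \<le> t \<longrightarrow> nonneg_matrix (\<sigma> t - \<sigma> s))"

text \<open>
  No one-sided continuity is assumed, while \<^const>\<open>interval_measure\<close> needs a
  right-continuous function; hence the passage to the right limit.
\<close>

definition stieltjes_measure :: "(real \<Rightarrow> real) \<Rightarrow> real measure" where
  "stieltjes_measure F = interval_measure (\<lambda>t. Lim (at_right t) F)"

definition trace_measure :: "('n::finite) matfun \<Rightarrow> real measure" where
  "trace_measure \<sigma> = stieltjes_measure (\<lambda>t. trace (\<sigma> t))"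

definition form_measure :: "('n::finite) matfun \<Rightarrow> real^'n \<Rightarrow> real measure" where
  "form_measure \<sigma> x = stieltjes_measure (\<lambda>t. x \<bullet> (\<sigma> t *v x))"

text \<open>
  The density of \<open>d\<sigma>\<close> with respect to the trace measure.  The entry (i, j) of \<open>d\<sigma>\<close> is a signed
  measure; by polarization it is a quarter of the difference of the nonnegative measures
  belonging to the vectors \<open>e\<^sub>i + e\<^sub>j\<close> and \<open>e\<^sub>i - e\<^sub>j\<close>, both dominated by a multiple of the trace
  measure.
\<close>

definition trace_density :: "('n::finite) matfun \<Rightarrow> real \<Rightarrow> real^'n^'n" where
  "trace_density \<sigma> t = (\<chi> i j.
     (enn2real (RN_deriv (trace_measure \<sigma>) (form_measure \<sigma> (axis i 1 + axis j 1)) t)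
      - enn2real (RN_deriv (trace_measure \<sigma>) (form_measure \<sigma> (axis i 1 - axis j 1)) t)) / 4)"

definition moments_exist :: "('n::finite) matfun \<Rightarrow> bool" where
  "moments_exist \<sigma> \<longleftrightarrow>
     (\<forall>k i j. integrable (trace_measure \<sigma>) (\<lambda>t. t ^ k * trace_density \<sigma> t $ i $ j))"

definition moment :: "('n::finite) matfun \<Rightarrow> nat \<Rightarrow> real^'n^'n" where
  "moment \<sigma> k = (\<chi> i j. integral\<^sup>L (trace_measure \<sigma>) (\<lambda>t. t ^ k * trace_density \<sigma> t $ i $ j))"

definition growth_points :: "('n::finite) matfun \<Rightarrow> real set" where
  "growth_points \<sigma> = {t. \<forall>\<epsilon>>0. \<sigma> (t + \<epsilon>) \<noteq> \<sigma> (t - \<epsilon>)}"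

text \<open>The class \<open>\<MM>(n,\<infinity>)\<close>.\<close>

definition sigma_class :: "('n::finite) matfun set" where
  "sigma_class = {\<sigma>. nondecreasing_matrix \<sigma> \<and> infinite (growth_points \<sigma>) \<and>
     moments_exist \<sigma> \<and> invertible (moment \<sigma> 0)}"

definition L2_integrand ::
  "('n::finite) matfun \<Rightarrow> (real \<Rightarrow> complex^'n) \<Rightarrow> (real \<Rightarrow> complex^'n) \<Rightarrow> real \<Rightarrow> complex" where
  "L2_integrand \<sigma> f g t =
     (\<Sum>i\<in>UNIV. \<Sum>j\<in>UNIV. cnj (f t $ i) * complex_of_real (trace_density \<sigma> t $ i $ j) * g t $ j)"

definition L2_space :: "('n::finite) matfun \<Rightarrow> (real \<Rightarrow> complex^'n) set" where
  "L2_space \<sigma> = {f. f \<in> borel_measurable borel \<and> integrable (trace_measure \<sigma>) (L2_integrand \<sigma> f f)}"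

definition L2_inner ::
  "('n::finite) matfun \<Rightarrow> (real \<Rightarrow> complex^'n) \<Rightarrow> (real \<Rightarrow> complex^'n) \<Rightarrow> complex" where
  "L2_inner \<sigma> f g = integral\<^sup>L (trace_measure \<sigma>) (L2_integrand \<sigma> f g)"

definition L2_norm :: "('n::finite) matfun \<Rightarrow> (real \<Rightarrow> complex^'n) \<Rightarrow> real" where
  "L2_norm \<sigma> f = sqrt (Re (L2_inner \<sigma> f f))"


section \<open>Vector polynomials\<close>

text \<open>
  Multiplication of \<open>r\<close> by a scalar polynomial \<open>R\<close> is \<open>R *s r\<close>; in particular \<open>[:0, 1:] *s r\<close> is
  \<open>z r(z)\<close>, and \<open>[:a:] *s r\<close> is the multiple by the number \<open>a\<close>.
\<close>

type_synonym 'n vpoly = "complex poly ^ 'n"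

definition vp_fun :: "'n vpoly \<Rightarrow> real \<Rightarrow> complex^'n" where
  "vp_fun r t = (\<chi> i. poly (r $ i) (complex_of_real t))"

definition height :: "('n::{finite,wellorder}) vpoly \<Rightarrow> ereal" where
  "height r = Max (range (\<lambda>j. if r $ j = 0 then -\<infinity>
                              else ereal (real (CARD('n) * degree (r $ j) + pos j))))"

text \<open>\<open>unit_vp (n k + i)\<close>, with \<open>1 \<le> i \<le> n\<close>, is \<open>z\<^sup>k e\<^sub>i\<close>.\<close>

definition unit_vp :: "nat \<Rightarrow> ('n::{finite,wellorder}) vpoly" where
  "unit_vp k = (\<chi> i. if (k - 1) mod CARD('n) = pos i then monom 1 ((k - 1) div CARD('n)) else 0)"


section \<open>Band matrices and their vector polynomials\<close>

definition diag_entry :: "(nat \<Rightarrow> nat \<Rightarrow> real) \<Rightarrow> nat \<Rightarrow> nat \<Rightarrow> real" where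
  "diag_entry A i k = A k (k + i)"

text \<open>
  The structure of \<open>A\<close> with respect to \<open>0 = m\<^sub>0 < m\<^sub>1 < ... < m\<^sub>j\<^sub>0\<close>, with \<open>m\<^sub>j\<^sub>0\<^sub>+\<^sub>1 = \<infinity>\<close>.
  Here the indices are only required to increase.  They are uniquely determined by \<open>A\<close>.
\<close>

definition degeneration_indices ::
  "nat \<Rightarrow> (nat \<Rightarrow> nat \<Rightarrow> real) \<Rightarrow> nat \<Rightarrow> (nat \<Rightarrow> nat) \<Rightarrow> bool" where
  "degeneration_indices n A j0 m \<longleftrightarrow>
     (\<forall>k\<ge>1. \<forall>l\<ge>1. A k l = A l k) \<and>
     (\<forall>k\<ge>1. \<forall>l\<ge>1. l > k + n \<or> k > l + n \<longrightarrow> A k l = 0) \<and>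
     j0 \<le> n - 1 \<and> m 0 = 0 \<and> (\<forall>j<j0. m j < m (Suc j)) \<and>
     (\<forall>j\<le>j0. \<forall>k. m j < k \<and> (j < j0 \<longrightarrow> k < m (Suc j)) \<longrightarrow> diag_entry A (n - j) k > 0) \<and>
     (\<forall>j<j0. \<forall>k\<ge>m (Suc j). diag_entry A (n - j) k = 0)"

text \<open>\<open>m\<^sub>1 > 1\<close> and \<open>m\<^sub>j + 1 < m\<^sub>j\<^sub>+\<^sub>1\<close>; the first inequality is the case \<open>j = 0\<close> because \<open>m\<^sub>0 = 0\<close>.\<close>

definition separated_indices :: "nat \<Rightarrow> (nat \<Rightarrow> nat) \<Rightarrow> bool" where
  "separated_indices j0 m \<longleftrightarrow> (\<forall>j<j0. m j + 1 < m (Suc j))"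

text \<open>The class \<open>\<M>(n,\<infinity>)\<close>.\<close>

definition band_class :: "nat \<Rightarrow> (nat \<Rightarrow> nat \<Rightarrow> real) set" where
  "band_class n = {A. \<exists>j0 m. degeneration_indices n A j0 m \<and> separated_indices j0 m}"

definition admissible_triangular :: "real^'n::{finite,wellorder}^'n::{finite,wellorder} \<Rightarrow> bool" where
  "admissible_triangular T \<longleftrightarrow> (\<forall>i j. j < i \<longrightarrow> T $ i $ j = 0) \<and> (\<forall>i. T $ i $ i \<noteq> 0)"

text \<open>
  In the two sums over lower indices, truncated subtraction sends every index below 1 to 0, and
  \<open>p 0 = 0\<close>, so these terms vanish as required.
\<close>

definition recurrence_polys ::
  "(nat \<Rightarrow> nat \<Rightarrow> real) \<Rightarrow> nat \<Rightarrow> (nat \<Rightarrow> nat) \<Rightarrow> real^'n::{finite,wellorder}^'n::{finite,wellorder} \<Rightarrow> (nat \<Rightarrow> 'n vpoly) \<Rightarrow> bool"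
  where
  "recurrence_polys A j0 m T p \<longleftrightarrow>
     (let n = CARD('n); d = (\<lambda>i k. [:complex_of_real (diag_entry A i k):]) in
       p 0 = 0 \<and>
       (\<forall>k\<in>{1..n}. p k = (\<chi> i j. [:complex_of_real (T $ i $ j):]) *v unit_vp k) \<and>
       (\<forall>k\<ge>1. k \<notin> m ` {1..j0} \<longrightarrow>
          (\<Sum>i<n. d (n - i) (k + i - n) *s p (k + i - n)) + d 0 k *s p k
            + (\<Sum>i=1..n. d i k *s p (k + i)) = [:0, 1:] *s p k))"

definition q_poly ::
  "(nat \<Rightarrow> nat \<Rightarrow> real) \<Rightarrow> (nat \<Rightarrow> nat) \<Rightarrow> (nat \<Rightarrow> 'n vpoly) \<Rightarrow> nat \<Rightarrow> ('n::{finite,wellorder}) vpoly" where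
  "q_poly A m p j =
     (let n = CARD('n); d = (\<lambda>i k. [:complex_of_real (diag_entry A i k):]) in
       ([:0, 1:] - d 0 (m j)) *s p (m j)
         - (\<Sum>k<n. d (n - k) (m j + k - n) *s p (m j + k - n))
         - (\<Sum>k=1..n - j. d k (m j) *s p (m j + k)))"

definition spectral_at ::
  "('n::{finite,wellorder}) matfun \<Rightarrow> (nat \<Rightarrow> nat \<Rightarrow> real) \<Rightarrow> nat \<Rightarrow> (nat \<Rightarrow> nat) \<Rightarrow> bool" where
  "spectral_at \<sigma> A j0 m \<longleftrightarrow>
     nondecreasing_matrix \<sigma> \<and> moments_exist \<sigma> \<and> invertible (moment \<sigma> 0) \<and>
     (\<exists>T p. admissible_triangular T \<and> recurrence_polys A j0 m T p \<and>
        (\<forall>k\<ge>1. vp_fun (p k) \<in> L2_space \<sigma>) \<and>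
        (\<forall>k\<ge>1. \<forall>l\<ge>1. L2_inner \<sigma> (vp_fun (p k)) (vp_fun (p l)) = (if k = l then 1 else 0)) \<and>
        (\<forall>j\<in>{1..j0}. vp_fun (q_poly A m p j) \<in> L2_space \<sigma> \<and>
                     L2_norm \<sigma> (vp_fun (q_poly A m p j)) = 0))"

text \<open>Spectral function of a matrix in \<open>\<M>(n,\<infinity>)\<close>; membership in the class is part of the notion.\<close>

definition spectral_function ::
  "('n::{finite,wellorder}) matfun \<Rightarrow> (nat \<Rightarrow> nat \<Rightarrow> real) \<Rightarrow> bool" where
  "spectral_function \<sigma> A \<longleftrightarrow>
     A \<in> band_class CARD('n) \<and>
     (\<exists>j0 m. degeneration_indices CARD('n) A j0 m \<and> separated_indices j0 m \<and> spectral_at \<sigma> A j0 m)"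

text \<open>
  The same notion without the two inequalities \<open>m\<^sub>1 > 1\<close> and \<open>m\<^sub>j + 1 < m\<^sub>j\<^sub>+\<^sub>1\<close>.  They can fail for
  the matrix obtained from a \<open>\<sigma>\<close> in \<open>\<MM>(n,\<infinity>)\<close>: let n = 2 and \<open>d\<sigma> = diag(\<delta>\<^sub>0, dt on [0,1])\<close>.  Then
  \<open>z e\<^sub>1\<close> has norm zero, the first row of the matrix \<open>c\<close> vanishes, and \<open>m\<^sub>1 = 1\<close>.  With n = 3 and
  \<open>d\<sigma> = diag(\<delta>\<^sub>0 + \<delta>\<^sub>1, \<delta>\<^sub>0 + \<delta>\<^sub>1, dt on [0,1])\<close> one gets \<open>m\<^sub>1 = 4\<close> and \<open>m\<^sub>2 = 5\<close>.
\<close>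

definition spectral_function_wide ::
  "('n::{finite,wellorder}) matfun \<Rightarrow> (nat \<Rightarrow> nat \<Rightarrow> real) \<Rightarrow> bool" where
  "spectral_function_wide \<sigma> A \<longleftrightarrow>
     (\<exists>j0 m. degeneration_indices CARD('n) A j0 m \<and> spectral_at \<sigma> A j0 m)"


section \<open>The Gram-Schmidt procedure\<close>

text \<open>
  \<open>gs \<sigma> k\<close> holds the lists of the orthonormal and of the null vector polynomials constructed in
  the steps 1, ..., k.
\<close>

fun gs :: "('n::{finite,wellorder}) matfun \<Rightarrow> nat \<Rightarrow> 'n vpoly list \<times> 'n vpoly list" where
  "gs \<sigma> 0 = ([], [])"
| "gs \<sigma> (Suc k) =
    (let (ps, qs) = gs \<sigma> k;
         e = unit_vp (Suc k);
         ph = e - (\<Sum>p\<leftarrow>ps. [:L2_inner \<sigma> (vp_fun p) (vp_fun e):] *s p)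
     in if \<exists>q\<in>set qs. \<exists>l\<ge>1. ereal (real k) = height q + ereal (real (CARD('n) * l)) then (ps, qs)
        else if L2_norm \<sigma> (vp_fun ph) = 0 then (ps, qs @ [ph])
        else (ps @ [[:complex_of_real (1 / L2_norm \<sigma> (vp_fun ph)):] *s ph], qs))"

definition gs_p :: "('n::{finite,wellorder}) matfun \<Rightarrow> nat \<Rightarrow> 'n vpoly" where
  "gs_p \<sigma> k = fst (gs \<sigma> (LEAST N. k \<le> length (fst (gs \<sigma> N)))) ! (k - 1)"

definition gs_q :: "('n::{finite,wellorder}) matfun \<Rightarrow> nat \<Rightarrow> 'n vpoly" where
  "gs_q \<sigma> j = snd (gs \<sigma> (LEAST N. j \<le> length (snd (gs \<sigma> N)))) ! (j - 1)"

definition gs_j0 :: "('n::{finite,wellorder}) matfun \<Rightarrow> nat" where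
  "gs_j0 \<sigma> = (LEAST j. \<forall>N. length (snd (gs \<sigma> N)) \<le> j)"

text \<open>
  \<open>gs_count \<sigma> j\<close> is the number of orthonormal polynomials constructed before the j-th null one; it
  equals \<open>n + m\<^sub>j - j\<close> for the indices \<open>m\<^sub>j\<close> of the resulting matrix.  Hence \<open>gs_separated \<sigma>\<close> says
  that \<open>m\<^sub>1 > 1\<close> and \<open>m\<^sub>j + 1 < m\<^sub>j\<^sub>+\<^sub>1\<close>: more than n orthonormal polynomials precede the first null
  one, and between two successive null polynomials at least one orthonormal polynomial is
  constructed.
\<close>

definition gs_count :: "('n::{finite,wellorder}) matfun \<Rightarrow> nat \<Rightarrow> nat" where
  "gs_count \<sigma> j = length (fst (gs \<sigma> (LEAST N. j \<le> length (snd (gs \<sigma> N)))))"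

definition gs_separated :: "('n::{finite,wellorder}) matfun \<Rightarrow> bool" where
  "gs_separated \<sigma> \<longleftrightarrow>
     (\<forall>j\<in>{1..gs_j0 \<sigma>}. CARD('n) < gs_count \<sigma> j) \<and>
     (\<forall>j\<in>{1..<gs_j0 \<sigma>}. gs_count \<sigma> j < gs_count \<sigma> (Suc j))"

end

theory Submission
  imports Defs
begin

text \<open>
  The density of \<open>d\<sigma>\<close> with respect to its trace measure is nonnegative almost everywhere, so
  vector polynomials carry a semidefinite inner product for which multiplication by z is symmetric,
  and \<open>c\<^sub>i\<^sub>k = \<langle>p\<^sub>i, z p\<^sub>k\<rangle>\<close> is real and symmetric.  The heights that carry no orthonormal polynomial are
  \<open>s\<^sub>j + n l\<close>, where the heights \<open>s\<^sub>j\<close> of the null polynomials are pairwise incongruent modulo n.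
  If these heights exhausted all residues, some nonzero scalar polynomial would annihilate \<open>d\<sigma>\<close>, and
  \<open>\<sigma>\<close> would have finitely many growth points; invertibility of \<open>S\<^sub>0\<close> gives \<open>s\<^sub>j \<ge> n\<close>.
  Let \<open>p\<^sub>k\<close> have height x.  Then \<open>c\<^sub>i\<^sub>k\<close> vanishes when \<open>p\<^sub>i\<close> is higher than x + n and is positive when
  \<open>p\<^sub>i\<close> has height x + n; the window from x + 1 to x + n contains
  \<open>n - |{j. s\<^sub>j \<le> x + n}|\<close> heights of orthonormal polynomials.  This gives the band structure, with
  \<open>m\<^sub>j\<close> the index of the orthonormal polynomial of height \<open>s\<^sub>j - n\<close>.
  The recurrence determines polynomials that agree with the Gram-Schmidt ones modulo null
  polynomials, which is enough for orthonormality and for \<open>q\<^sub>j\<close> to be null.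
\<close>

section \<open>Right limits and Stieltjes measures\<close>

text \<open>For a monotone function the right limit is the infimum of the values to the right, and
  all three facts are read off from that infimum.\<close>

lemma right_limit_mono:
  fixes F :: "real \<Rightarrow> real"
  assumes "mono F"
  shows tendsto_right_limit_mono: "(F \<longlongrightarrow> Lim (at_right t) F) (at_right t)"
    and right_limit_mono_ge: "F t \<le> Lim (at_right t) F"
    and right_limit_mono_le: "t < u \<Longrightarrow> Lim (at_right t) F \<le> F u"
proof -
  let ?I = "INF u\<in>{t<..}. F u"
  have bb: "bdd_below (F ` {t<..})"
    using assms by (intro bdd_belowI[of _ "F t"]) (auto simp: mono_def)
  have le: "?I \<le> F u" if "t < u" for u
    using bb that by (intro cINF_lower) auto
  have lim: "(F \<longlongrightarrow> ?I) (at_right t)"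
  proof (rule order_tendstoI)
    fix y assume "y < ?I"
    have "eventually (\<lambda>u. t < u) (at_right t)" by (simp add: eventually_at_right_less)
    then show "eventually (\<lambda>u. y < F u) (at_right t)"
    proof eventually_elim
      case (elim u)
      then show ?case using le[of u] \<open>y < ?I\<close> by simp
    qed
  next
    fix y assume "?I < y"
    then obtain u where u: "t < u" "F u < y"
      using cINF_less_iff[OF _ bb, of y] by auto
    then have "eventually (\<lambda>v. v < u) (at_right t)"
      using u(1) by (auto simp: eventually_at_right_field)
    then show "eventually (\<lambda>v. F v < y) (at_right t)"
    proof eventually_elim
      case (elim v)
      then show ?case using u(2) monoD[OF assms, of v u] by simp
    qed
  qed
  then have eq: "Lim (at_right t) F = ?I" by (intro tendsto_Lim) auto
  show "(F \<longlongrightarrow> Lim (at_right t) F) (at_right t)" using lim eq by simp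
  show "F t \<le> Lim (at_right t) F"
    unfolding eq using assms by (intro cINF_greatest) (auto simp: mono_def)
  show "t < u \<Longrightarrow> Lim (at_right t) F \<le> F u" using le eq by simp
qed

text \<open>Passing to right limits gives the right-continuous integrator on which
  \<open>interval_measure\<close> behaves as a Stieltjes measure.\<close>

lemma
  fixes F :: "real \<Rightarrow> real"
  assumes "mono F"
  shows mono_right_limit: "mono (\<lambda>t. Lim (at_right t) F)"
    and continuous_right_limit: "continuous (at_right a) (\<lambda>t. Lim (at_right t) F)"
proof -
  let ?G = "\<lambda>t. Lim (at_right t) F"
  note G = right_limit_mono[OF assms]
  show mono: "mono ?G"
  proof (rule monoI)
    fix s t :: real assume "s \<le> t"
    then show "?G s \<le> ?G t"
      using G(3)[of s t] G(2)[of t] by (cases "s = t") auto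
  qed
  show "continuous (at_right a) ?G"
    unfolding continuous_within
  proof (rule order_tendstoI)
    fix y assume "y < ?G a"
    have "eventually (\<lambda>u. a < u) (at_right a)" by (simp add: eventually_at_right_less)
    then show "eventually (\<lambda>u. y < ?G u) (at_right a)"
    proof eventually_elim
      case (elim u)
      then show ?case using monoD[OF mono, of a u] \<open>y < ?G a\<close> by simp
    qed
  next
    fix y assume "?G a < y"
    then have "eventually (\<lambda>u. F u < y) (at_right a)"
      using G(1)[of a] by (rule order_tendstoD(2)[rotated])
    then obtain b where b: "a < b" "\<And>u. a < u \<Longrightarrow> u < b \<Longrightarrow> F u < y"
      by (metis eventually_at_right lt_ex less_add_one)
    \<comment> \<open>One value \<open>F c\<close> below \<open>y\<close> to the right of
      \<open>a\<close> bounds the right limits at all points before \<open>c\<close>.\<close>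
    define c where "c = (a + b) / 2"
    have c: "a < c" "F c < y" using b by (auto simp: c_def)
    have "eventually (\<lambda>v. v < c) (at_right a)"
      using c(1) by (auto simp: eventually_at_right_field)
    then show "eventually (\<lambda>v. ?G v < y) (at_right a)"
    proof eventually_elim
      case (elim v)
      then show ?case using c(2) G(3)[of v c] by simp
    qed
  qed
qed

section \<open>Stieltjes measures as additive functions of the integrator\<close>

lemma sets_stieltjes_measure [simp, measurable_cong]: "sets (stieltjes_measure F) = sets borel"
  by (simp add: stieltjes_measure_def)

lemma space_stieltjes_measure [simp]: "space (stieltjes_measure F) = UNIV"
  by (simp add: stieltjes_measure_def)

lemma emeasure_stieltjes_measure_Ioc:
  assumes "mono F" "a \<le> b"
  shows "emeasure (stieltjes_measure F) {a<..b} =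
    ennreal (Lim (at_right b) F - Lim (at_right a) F)"
  unfolding stieltjes_measure_def using assms mono_right_limit[OF assms(1)]
  by (intro emeasure_interval_measure_Ioc continuous_right_limit) (auto simp: mono_def)

lemma sigma_finite_stieltjes_measure: "mono F \<Longrightarrow> sigma_finite_measure (stieltjes_measure F)"
  unfolding stieltjes_measure_def using mono_right_limit[of F]
  by (intro sigma_finite_interval_measure continuous_right_limit) (auto simp: mono_def)

text \<open>The weighted sum of measures is packaged as a measure \<open>M\<close>. Right limits are
  additive, so both measures agree on half-open intervals, an intersection-stable generator of the
  Borel sets.\<close>

lemma emeasure_stieltjes_measure_sum:
  assumes "finite I" and mono: "\<And>i. i \<in> I \<Longrightarrow> mono (F i)" and nn: "\<And>i. i \<in> I \<Longrightarrow> 0 \<le> a i"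
    and E: "E \<in> sets borel"
  shows "emeasure (stieltjes_measure (\<lambda>t. \<Sum>i\<in>I. a i * F i t)) E =
    (\<Sum>i\<in>I. ennreal (a i) * emeasure (stieltjes_measure (F i)) E)"
proof -
  let ?S = "\<lambda>t. \<Sum>i\<in>I. a i * F i t"
  let ?\<mu> = "\<lambda>E. \<Sum>i\<in>I. ennreal (a i) * emeasure (stieltjes_measure (F i)) E"
  define M where "M = measure_of UNIV (sets borel) ?\<mu>"
  have sets_M: "sets M = sets borel"
    unfolding M_def by (metis sets.sets_measure_of_eq space_borel)
  have em: "emeasure M A = ?\<mu> A" if "A \<in> sets borel" for A
    unfolding M_def
  proof (rule emeasure_measure_of_sigma)
    show "sigma_algebra UNIV (sets (borel :: real measure))"
      by (metis sets.sigma_algebra_axioms space_borel)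
    show "positive (sets borel) ?\<mu>" by (simp add: positive_def)
    show "countably_additive (sets borel) ?\<mu>"
    proof (rule countably_additiveI)
      fix A :: "nat \<Rightarrow> real set"
      assume A: "range A \<subseteq> sets borel" "disjoint_family A"
      have "(\<Sum>n. ?\<mu> (A n)) = (\<Sum>i\<in>I. \<Sum>n. ennreal (a i) * emeasure (stieltjes_measure (F i)) (A n))"
        by (intro suminf_sum) auto
      also have "\<dots> = ?\<mu> (\<Union> (range A))"
        using A by (intro sum.cong refl) (simp add: suminf_emeasure)
      finally show "(\<Sum>n. ?\<mu> (A n)) = ?\<mu> (\<Union> (range A))" .
    qed
  qed (use that in auto)
  have mono_S: "mono ?S"
    using mono nn by (auto simp: mono_def intro!: sum_mono mult_left_mono)
  have lim_S: "Lim (at_right t) ?S = (\<Sum>i\<in>I. a i * Lim (at_right t) (F i))" for t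
    by (intro tendsto_Lim tendsto_sum tendsto_mult tendsto_const tendsto_right_limit_mono mono) auto
  have Ioc: "emeasure (stieltjes_measure ?S) {c<..d} = emeasure M {c<..d}" for c d
  proof (cases "c \<le> d")
    case True
    have "emeasure M {c<..d} =
      (\<Sum>i\<in>I. ennreal (a i * (Lim (at_right d) (F i) - Lim (at_right c) (F i))))"
      using True nn mono mono_right_limit[OF mono]
      by (subst em) (auto simp: emeasure_stieltjes_measure_Ioc ennreal_mult mono_def intro!: sum.cong)
    also have "\<dots> = ennreal (\<Sum>i\<in>I. a i * (Lim (at_right d) (F i) - Lim (at_right c) (F i)))"
      using nn mono_right_limit[OF mono] True by (intro sum_ennreal) (auto simp: mono_def)
    also have "\<dots> = emeasure (stieltjes_measure ?S) {c<..d}"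
      using True by (subst emeasure_stieltjes_measure_Ioc[OF mono_S])
        (auto simp: lim_S sum_subtractf algebra_simps)
    finally show ?thesis by simp
  qed auto
  have "stieltjes_measure ?S = M"
  proof (rule measure_eqI_generator_eq[where E = "range (\<lambda>(a, b). {a<..b})" and \<Omega> = UNIV
        and A = "\<lambda>n. {- real n<..real n}"])
    show "Int_stable (range (\<lambda>(a, b). {a<..b::real}))"
      by (auto simp: Int_stable_def)
    show "(\<Union>i. {- real i<..real i}) = UNIV"
    proof safe
      fix x :: real
      obtain n :: nat where "\<bar>x\<bar> < real n" using reals_Archimedean2 by blast
      then show "x \<in> (\<Union>i. {- real i<..real i})" by (intro UN_I[of n]) auto
    qed auto
    show "sets (stieltjes_measure ?S) = sigma_sets UNIV (range (\<lambda>(a, b). {a<..b}))"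
      by (simp add: borel_sigma_sets_Ioc)
    show "sets M = sigma_sets UNIV (range (\<lambda>(a, b). {a<..b}))"
      by (simp add: borel_sigma_sets_Ioc sets_M)
    show "emeasure (stieltjes_measure ?S) {- real n<..real n} \<noteq> \<infinity>" for n
      by (simp add: emeasure_stieltjes_measure_Ioc[OF mono_S])
  qed (auto simp: Ioc)
  then show ?thesis using em[OF E] by simp
qed

lemma emeasure_stieltjes_measure_add:
  assumes "mono F" "mono G" "E \<in> sets borel"
  shows "emeasure (stieltjes_measure (\<lambda>t. F t + G t)) E =
    emeasure (stieltjes_measure F) E + emeasure (stieltjes_measure G) E"
  using emeasure_stieltjes_measure_sum[of UNIV "\<lambda>b. if b then F else G" "\<lambda>_. 1" E] assms
  by (simp add: UNIV_bool add.commute)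

lemma emeasure_stieltjes_measure_cmult:
  assumes "mono F" "0 \<le> a" "E \<in> sets borel"
  shows "emeasure (stieltjes_measure (\<lambda>t. a * F t)) E =
    ennreal a * emeasure (stieltjes_measure F) E"
  using emeasure_stieltjes_measure_sum[of "{()}" "\<lambda>_. F" "\<lambda>_. a" E] assms by simp

text \<open>Domination: \<open>F\<close> and \<open>a * T - F\<close> are monotone with sum
  \<open>a * T\<close>, so by additivity the measure of \<open>F\<close> is at most \<open>a\<close>
  times that of \<open>T\<close>.\<close>

lemma absolutely_continuous_stieltjes_measure:
  assumes "mono F" "0 \<le> a" "mono T" "mono (\<lambda>t. a * T t - F t)"
  shows "absolutely_continuous (stieltjes_measure T) (stieltjes_measure F)"
  unfolding absolutely_continuous_def
proof
  fix E assume "E \<in> null_sets (stieltjes_measure T)"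
  then have E: "E \<in> sets borel" "emeasure (stieltjes_measure T) E = 0" by auto
  have "emeasure (stieltjes_measure F) E + emeasure (stieltjes_measure (\<lambda>t. a * T t - F t)) E =
    ennreal a * emeasure (stieltjes_measure T) E"
    using emeasure_stieltjes_measure_add[OF assms(1,4) E(1)]
      emeasure_stieltjes_measure_cmult[OF assms(3,2) E(1)] by simp
  then show "E \<in> null_sets (stieltjes_measure F)" using E by auto
qed

section \<open>Densities of one Stieltjes measure with respect to another\<close>

definition stieltjes_density :: "(real \<Rightarrow> real) \<Rightarrow> (real \<Rightarrow> real) \<Rightarrow> real \<Rightarrow> real" where
  "stieltjes_density T F t = enn2real (RN_deriv (stieltjes_measure T) (stieltjes_measure F) t)"

lemma stieltjes_density_self:
  assumes "mono T"
  shows "AE t in stieltjes_measure T. stieltjes_density T T t = 1"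
proof -
  interpret sigma_finite_measure "stieltjes_measure T"
    using assms by (rule sigma_finite_stieltjes_measure)
  have "AE t in stieltjes_measure T. 1 = RN_deriv (stieltjes_measure T) (stieltjes_measure T) t"
    by (rule RN_deriv_unique) (simp_all add: density_1)
  then show ?thesis by eventually_elim (simp add: stieltjes_density_def flip: one_ennreal_def)
qed

text \<open>The weights may be negative while measures are not. Each weight is split into its
  positive part \<open>?p\<close> and negative part \<open>?m\<close>; with the negative parts moved
  to the other side, both sides are measures, and uniqueness of densities applies.\<close>

lemma stieltjes_density_linear:
  fixes F :: "'i \<Rightarrow> real \<Rightarrow> real"
  assumes T: "mono T" and I: "finite I"
    and mono: "mono G" "\<And>i. i \<in> I \<Longrightarrow> mono (F i)"
    and ac: "absolutely_continuous (stieltjes_measure T) (stieltjes_measure G)"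
      "\<And>i. i \<in> I \<Longrightarrow> absolutely_continuous (stieltjes_measure T) (stieltjes_measure (F i))"
    and eq: "\<And>t. G t = (\<Sum>i\<in>I. a i * F i t)"
  shows "AE t in stieltjes_measure T.
    stieltjes_density T G t = (\<Sum>i\<in>I. a i * stieltjes_density T (F i) t)"
proof -
  let ?M = "stieltjes_measure T"
  let ?h = "\<lambda>F. RN_deriv ?M (stieltjes_measure F)"
  let ?p = "\<lambda>i. max 0 (a i)" and ?m = "\<lambda>i. max 0 (- a i)"
  interpret sigma_finite_measure ?M using T by (rule sigma_finite_stieltjes_measure)
  have h: "emeasure (stieltjes_measure F) E = (\<integral>\<^sup>+t. ?h F t * indicator E t \<partial>?M)"
    if "absolutely_continuous ?M (stieltjes_measure F)" "E \<in> sets borel" for F E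
    using density_RN_deriv[OF that(1)] that(2) by (metis emeasure_density sets_stieltjes_measure borel_measurable_RN_deriv)
  have sum_h: "(\<Sum>i\<in>I. ennreal (b i) * emeasure (stieltjes_measure (F i)) E) =
     (\<integral>\<^sup>+t. (\<Sum>i\<in>I. ennreal (b i) * ?h (F i) t) * indicator E t \<partial>?M)"
    if E: "E \<in> sets borel" for E b
  proof -
    have "(\<Sum>i\<in>I. ennreal (b i) * emeasure (stieltjes_measure (F i)) E) =
      (\<Sum>i\<in>I. \<integral>\<^sup>+t. ennreal (b i) * (?h (F i) t * indicator E t) \<partial>?M)"
      using E by (intro sum.cong refl) (simp add: h ac(2) nn_integral_cmult)
    also have "\<dots> = (\<integral>\<^sup>+t. (\<Sum>i\<in>I. ennreal (b i) * (?h (F i) t * indicator E t)) \<partial>?M)"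
      using E by (intro nn_integral_sum[symmetric]) auto
    finally show ?thesis by (simp add: sum_distrib_right mult.assoc)
  qed
  have p_m: "?p i = a i + ?m i" for i by auto
  have eq': "G t + (\<Sum>i\<in>I. ?m i * F i t) = (\<Sum>i\<in>I. ?p i * F i t)" for t
    unfolding p_m by (simp add: eq algebra_simps sum.distrib)
  have "density ?M (\<lambda>t. ?h G t + (\<Sum>i\<in>I. ennreal (?m i) * ?h (F i) t)) =
    density ?M (\<lambda>t. \<Sum>i\<in>I. ennreal (?p i) * ?h (F i) t)" (is "?L = ?R")
  proof (rule measure_eqI)
    fix E assume "E \<in> sets ?L"
    then have E: "E \<in> sets borel" by simp
    have mono_m: "mono (\<lambda>t. \<Sum>i\<in>I. ?m i * F i t)"
      using mono(2) by (auto simp: mono_def intro!: sum_mono mult_left_mono)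
    have "emeasure ?L E = emeasure (stieltjes_measure G) E
       + (\<Sum>i\<in>I. ennreal (?m i) * emeasure (stieltjes_measure (F i)) E)"
      using E by (simp add: emeasure_density sum_h h[OF ac(1)] distrib_right nn_integral_add)
    also have "\<dots> = emeasure (stieltjes_measure (\<lambda>t. G t + (\<Sum>i\<in>I. ?m i * F i t))) E"
      using E I mono mono_m
      by (subst emeasure_stieltjes_measure_add) (auto simp: emeasure_stieltjes_measure_sum)
    also have "\<dots> = (\<Sum>i\<in>I. ennreal (?p i) * emeasure (stieltjes_measure (F i)) E)"
      unfolding eq' using E I mono by (intro emeasure_stieltjes_measure_sum) auto
    also have "\<dots> = emeasure ?R E"
      using E by (simp add: emeasure_density sum_h)
    finally show "emeasure ?L E = emeasure ?R E" .
  qed simp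
  then have "AE t in ?M. ?h G t + (\<Sum>i\<in>I. ennreal (?m i) * ?h (F i) t) =
      (\<Sum>i\<in>I. ennreal (?p i) * ?h (F i) t)"
    by (intro density_unique) measurable
  \<comment> \<open>\<open>enn2real\<close> sends an infinite value to 0; finiteness almost
    everywhere allows the passage from extended to real densities.\<close>
  moreover have "AE t in ?M. ?h G t \<noteq> \<infinity>"
    using mono(1) ac(1) by (intro RN_deriv_finite sigma_finite_stieltjes_measure) auto
  moreover have "AE t in ?M. \<forall>i\<in>I. ?h (F i) t \<noteq> \<infinity>"
    using mono(2) ac(2) I
    by (intro AE_finite_allI RN_deriv_finite sigma_finite_stieltjes_measure) auto
  ultimately show ?thesis
  proof eventually_elim
    case (elim t)
    have en: "?h G t = ennreal (stieltjes_density T G t)"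
      "\<And>i. i \<in> I \<Longrightarrow> ?h (F i) t = ennreal (stieltjes_density T (F i) t)"
      using elim by (auto simp: stieltjes_density_def less_top)
    have nn: "0 \<le> stieltjes_density T F t" for F by (simp add: stieltjes_density_def)
    have "ennreal (stieltjes_density T G t + (\<Sum>i\<in>I. ?m i * stieltjes_density T (F i) t)) =
      ennreal (\<Sum>i\<in>I. ?p i * stieltjes_density T (F i) t)"
      using elim(1) nn by (simp add: en ennreal_plus sum_nonneg flip: ennreal_mult sum_ennreal cong: sum.cong)
    then have "stieltjes_density T G t + (\<Sum>i\<in>I. ?m i * stieltjes_density T (F i) t) =
      (\<Sum>i\<in>I. ?p i * stieltjes_density T (F i) t)"
      using nn by (subst (asm) ennreal_inj) (auto intro!: add_nonneg_nonneg sum_nonneg)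
    then show ?case unfolding p_m by (simp add: algebra_simps sum.distrib)
  qed
qed

section \<open>The density with respect to the trace measure\<close>

lemma quadratic_form_eq_sum:
  fixes M :: "real^'n^'n"
  shows "x \<bullet> (M *v x) = (\<Sum>i\<in>UNIV. \<Sum>j\<in>UNIV. x $ i * x $ j * M $ i $ j)"
  by (simp add: inner_vec_def matrix_vector_mult_def sum_distrib_left mult_ac)

lemma quadratic_form_axis_plus:
  fixes M :: "real^'n^'n"
  shows "(axis i 1 + axis j 1) \<bullet> (M *v (axis i 1 + axis j 1)) = M$i$i + M$i$j + M$j$i + M$j$j"
  by (simp add: matrix_vector_right_distrib matrix_vector_mul_component inner_add_left inner_add_right
      inner_axis' inner_axis row_def matrix_vector_mult_basis column_def)

lemma quadratic_form_axis_minus: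
  fixes M :: "real^'n^'n"
  shows "(axis i 1 - axis j 1) \<bullet> (M *v (axis i 1 - axis j 1)) = M$i$i - M$i$j - M$j$i + M$j$j"
  by (simp add: matrix_vector_mult_diff_distrib matrix_vector_mul_component inner_diff_left inner_diff_right
      inner_axis' inner_axis row_def matrix_vector_mult_basis column_def)

text \<open>The form at \<open>axis i 1 + axis j 1\<close> and \<open>axis i 1 - axis j 1\<close>
  bounds twice the modulus of the entry by the sum of two diagonal entries, each at most the
  trace.\<close>

lemma nonneg_matrix_entry_le_trace:
  fixes M :: "real^'n^'n"
  assumes "nonneg_matrix M"
  shows "\<bar>M $ i $ j\<bar> \<le> trace M"
proof -
  have sym: "M $ j $ i = M $ i $ j"
    using assms unfolding nonneg_matrix_def transpose_def by (metis vec_lambda_beta)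
  have nn: "0 \<le> x \<bullet> (M *v x)" for x using assms by (simp add: nonneg_matrix_def)
  have diag: "0 \<le> M $ k $ k" for k
    using nn[of "axis k 1"] by (simp add: matrix_vector_mult_basis column_def inner_axis')
  have le: "M $ k $ k \<le> trace M" for k
    unfolding trace_def using diag by (intro member_le_sum) auto
  show ?thesis
    using nn[of "axis i 1 + axis j 1"] nn[of "axis i 1 - axis j 1"] le[of i] le[of j] sym
    unfolding quadratic_form_axis_plus quadratic_form_axis_minus by auto
qed

context
  fixes \<sigma> :: "('n::finite) matfun"
  assumes nondecreasing: "nondecreasing_matrix \<sigma>"
begin

lemma nonneg_matrix_increment: "s \<le> t \<Longrightarrow> nonneg_matrix (\<sigma> t - \<sigma> s)"
  using nondecreasing by (simp add: nondecreasing_matrix_def)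

lemma mono_form: "mono (\<lambda>t. x \<bullet> (\<sigma> t *v x))"
  using nonneg_matrix_increment
  by (auto simp: mono_def nonneg_matrix_def matrix_vector_mult_diff_rdistrib inner_diff_right)

lemma mono_trace: "mono (\<lambda>t. trace (\<sigma> t))"
proof (rule monoI)
  fix s t :: real assume "s \<le> t"
  then have "0 \<le> trace (\<sigma> t - \<sigma> s)"
    using nonneg_matrix_entry_le_trace[OF nonneg_matrix_increment] by (meson abs_ge_zero order_trans)
  then show "trace (\<sigma> s) \<le> trace (\<sigma> t)" by (simp add: trace_sub)
qed

lemma absolutely_continuous_form:
  "absolutely_continuous (trace_measure \<sigma>) (form_measure \<sigma> x)"
  unfolding trace_measure_def form_measure_def
proof (rule absolutely_continuous_stieltjes_measure)
  \<comment> \<open>Entries of an increment are bounded by its trace, so this sum of absolute values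
    dominates the form by a multiple of the trace.\<close>
  let ?C = "\<Sum>i\<in>UNIV. \<Sum>j\<in>UNIV. \<bar>x $ i * x $ j\<bar>"
  show "0 \<le> ?C" by (intro sum_nonneg) auto
  show "mono (\<lambda>t. ?C * trace (\<sigma> t) - x \<bullet> (\<sigma> t *v x))"
  proof (rule monoI)
    fix s t :: real assume st: "s \<le> t"
    define M where "M = \<sigma> t - \<sigma> s"
    have "x \<bullet> (M *v x) \<le> (\<Sum>i\<in>UNIV. \<Sum>j\<in>UNIV. \<bar>x $ i * x $ j\<bar> * trace M)"
      unfolding quadratic_form_eq_sum
    proof (intro sum_mono)
      fix i j
      have "x $ i * x $ j * M $ i $ j \<le> \<bar>x $ i * x $ j\<bar> * \<bar>M $ i $ j\<bar>"
        by (simp flip: abs_mult)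
      also have "\<dots> \<le> \<bar>x $ i * x $ j\<bar> * trace M"
        using nonneg_matrix_entry_le_trace[OF nonneg_matrix_increment[OF st]]
        by (intro mult_left_mono) (auto simp: M_def)
      finally show "x $ i * x $ j * M $ i $ j \<le> \<bar>x $ i * x $ j\<bar> * trace M" .
    qed
    also have "\<dots> = ?C * trace M" by (simp add: sum_distrib_right)
    finally show "?C * trace (\<sigma> s) - x \<bullet> (\<sigma> s *v x) \<le> ?C * trace (\<sigma> t) - x \<bullet> (\<sigma> t *v x)"
      by (simp add: M_def matrix_vector_mult_diff_rdistrib inner_diff_right trace_sub right_diff_distrib)
  qed
qed (rule mono_form mono_trace)+

lemma trace_density_eq:
  "trace_density \<sigma> t $ i $ j =
    (stieltjes_density (\<lambda>t. trace (\<sigma> t)) (\<lambda>t. (axis i 1 + axis j 1) \<bullet> (\<sigma> t *v (axis i 1 + axis j 1))) t -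
     stieltjes_density (\<lambda>t. trace (\<sigma> t)) (\<lambda>t. (axis i 1 - axis j 1) \<bullet> (\<sigma> t *v (axis i 1 - axis j 1))) t) / 4"
  by (simp add: trace_density_def stieltjes_density_def trace_measure_def form_measure_def)

lemma matfun_sym: "\<sigma> t $ j $ i = \<sigma> t $ i $ j"
  using nondecreasing unfolding nondecreasing_matrix_def transpose_def by (metis vec_lambda_beta)

text \<open>Swapping \<open>i\<close> and \<open>j\<close> leaves both polarizing forms unchanged as
  functions, so symmetry holds at every point and not only almost everywhere.\<close>

lemma trace_density_sym: "trace_density \<sigma> t $ j $ i = trace_density \<sigma> t $ i $ j"
  unfolding trace_density_eq quadratic_form_axis_plus quadratic_form_axis_minus
  by (simp add: matfun_sym algebra_simps)

text \<open>Polarization writes every entry of \<sigma> through quadratic forms, to which linearity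
  of densities applies. The uses are the trace and the quadratic form of a fixed vector.\<close>

lemma polarized_density:
  assumes "mono G" "absolutely_continuous (trace_measure \<sigma>) (stieltjes_measure G)"
    and eq: "\<And>t. G t = (\<Sum>i\<in>UNIV. \<Sum>j\<in>UNIV. w i j * \<sigma> t $ i $ j)"
  shows "AE t in trace_measure \<sigma>. stieltjes_density (\<lambda>t. trace (\<sigma> t)) G t =
    (\<Sum>i\<in>UNIV. \<Sum>j\<in>UNIV. w i j * trace_density \<sigma> t $ i $ j)"
proof -
  \<comment> \<open>The boolean in the index selects the sum or the difference of two basis vectors;
    the weight carries the sign and the factor 1/4 of polarization.\<close>
  define v :: "'n \<times> 'n \<times> bool \<Rightarrow> real^'n"
    where "v = (\<lambda>(i, j, b). if b then axis i 1 + axis j 1 else axis i 1 - axis j 1)"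
  define a where "a = (\<lambda>(i, j, b). if b then w i j / 4 else - w i j / 4)"
  let ?F = "\<lambda>k t. v k \<bullet> (\<sigma> t *v v k)"
  have sum: "(\<Sum>k\<in>UNIV. a k * f k) = (\<Sum>i\<in>UNIV. \<Sum>j\<in>UNIV. w i j * ((f (i, j, True) - f (i, j, False)) / 4))"
    for f :: "'n \<times> 'n \<times> bool \<Rightarrow> real"
    unfolding UNIV_Times_UNIV[symmetric]
    by (simp add: sum.cartesian_product' a_def UNIV_bool field_simps)
  have "AE t in trace_measure \<sigma>. stieltjes_density (\<lambda>t. trace (\<sigma> t)) G t =
      (\<Sum>k\<in>UNIV. a k * stieltjes_density (\<lambda>t. trace (\<sigma> t)) (?F k) t)"
    unfolding trace_measure_def
  proof (rule stieltjes_density_linear)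
    show "G t = (\<Sum>k\<in>UNIV. a k * ?F k t)" for t
      unfolding sum eq v_def
      by (simp add: quadratic_form_axis_plus quadratic_form_axis_minus matfun_sym)
  qed (use assms absolutely_continuous_form in
    \<open>auto simp: mono_trace mono_form trace_measure_def form_measure_def\<close>)
  then show ?thesis
    unfolding sum trace_density_eq v_def by simp
qed

text \<open>The left side is the density of the trace measure with respect to itself. So the density
  matrix is nonzero almost everywhere.\<close>

lemma trace_density_trace: "AE t in trace_measure \<sigma>. (\<Sum>i\<in>UNIV. trace_density \<sigma> t $ i $ i) = 1"
proof -
  have *: "(\<Sum>i\<in>UNIV. \<Sum>j\<in>UNIV. of_bool (i = j) * M $ i $ j) = (\<Sum>i\<in>UNIV. M $ i $ i)"
    for M :: "real^'n^'n"
    by (simp add: of_bool_def if_distrib[of "\<lambda>x. x * _"] cong: if_cong)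
  have "AE t in trace_measure \<sigma>. stieltjes_density (\<lambda>t. trace (\<sigma> t)) (\<lambda>t. trace (\<sigma> t)) t =
    (\<Sum>i\<in>UNIV. \<Sum>j\<in>UNIV. of_bool (i = j) * trace_density \<sigma> t $ i $ j)"
    by (rule polarized_density)
      (auto simp: mono_trace * trace_def[symmetric] trace_measure_def absolutely_continuous_def)
  moreover have "AE t in trace_measure \<sigma>. stieltjes_density (\<lambda>t. trace (\<sigma> t)) (\<lambda>t. trace (\<sigma> t)) t = 1"
    unfolding trace_measure_def by (intro stieltjes_density_self mono_trace)
  ultimately show ?thesis by eventually_elim (simp add: *)
qed

text \<open>For fixed \<open>x\<close> the form is a density of a nonnegative measure, but the
  exceptional null set depends on \<open>x\<close>. A countable dense set of vectors gives one null
  set, and continuity in \<open>x\<close> does the rest.\<close>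

lemma trace_density_nonneg: "AE t in trace_measure \<sigma>. \<forall>x. 0 \<le> x \<bullet> (trace_density \<sigma> t *v x)"
proof -
  obtain S :: "(real^'n) set" where S: "countable S"
    "\<And>U. open U \<Longrightarrow> U \<noteq> {} \<Longrightarrow> \<exists>d\<in>S. d \<in> U"
    using countable_dense_exists by blast
  have "AE t in trace_measure \<sigma>. 0 \<le> x \<bullet> (trace_density \<sigma> t *v x)" for x
  proof -
    have "AE t in trace_measure \<sigma>. stieltjes_density (\<lambda>t. trace (\<sigma> t)) (\<lambda>t. x \<bullet> (\<sigma> t *v x)) t =
      (\<Sum>i\<in>UNIV. \<Sum>j\<in>UNIV. x $ i * x $ j * trace_density \<sigma> t $ i $ j)"
      using absolutely_continuous_form
      by (intro polarized_density mono_form) (auto simp: quadratic_form_eq_sum form_measure_def)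
    then show ?thesis
    proof eventually_elim
      case (elim t)
      show ?case unfolding quadratic_form_eq_sum elim[symmetric] by (simp add: stieltjes_density_def)
    qed
  qed
  then have "AE t in trace_measure \<sigma>. \<forall>x\<in>S. 0 \<le> x \<bullet> (trace_density \<sigma> t *v x)"
    using S(1) by (simp add: AE_ball_countable)
  then show ?thesis
  proof eventually_elim
    case (elim t)
    have "closed {x. 0 \<le> x \<bullet> (trace_density \<sigma> t *v x)}"
      by (intro closed_Collect_le continuous_intros matrix_vector_mult_linear_continuous_on)
    then have o: "open {x. x \<bullet> (trace_density \<sigma> t *v x) < 0}"
      by (simp add: closed_def Collect_neg_eq[symmetric] not_le)
    show ?case
    proof (rule ccontr)
      assume "\<not> ?case"
      then have "{x. x \<bullet> (trace_density \<sigma> t *v x) < 0} \<noteq> {}" by (auto simp: not_le)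
      with S(2)[OF o] elim show False by fastforce
    qed
  qed
qed

text \<open>A point off \<open>Z\<close> has a neighbourhood of trace measure zero. There the trace
  is constant, and by the entry bound so is \<sigma>.\<close>

lemma growth_points_subset:
  assumes "finite Z" and null: "AE t in trace_measure \<sigma>. t \<in> Z"
  shows "growth_points \<sigma> \<subseteq> Z"
proof
  fix t assume t: "t \<in> growth_points \<sigma>"
  show "t \<in> Z"
  proof (rule ccontr)
    assume "t \<notin> Z"
    moreover have "open (- Z)" using assms(1) finite_imp_closed by auto
    ultimately obtain e where e: "e > 0" "ball t e \<subseteq> - Z"
      by (meson ComplI openE)
    \<comment> \<open>The values at \<open>t - d\<close> and \<open>t + d\<close> are squeezed
      between the right limits at \<open>t - 2 * d\<close> and \<open>t + 2 * d\<close>, and this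
      larger interval still avoids \<open>Z\<close>.\<close>
    define d where "d = e / 3"
    let ?L = "\<lambda>s. Lim (at_right s) (\<lambda>t. trace (\<sigma> t))"
    note L = right_limit_mono[OF mono_trace]
    have sub: "{t - 2 * d<..t + 2 * d} \<inter> Z = {}"
      using e by (auto simp: d_def dist_real_def subset_iff)
    have "AE s in trace_measure \<sigma>. s \<notin> {t - 2 * d<..t + 2 * d}"
      using null by eventually_elim (use sub in blast)
    then have "emeasure (trace_measure \<sigma>) {t - 2 * d<..t + 2 * d} = 0"
      by (subst (asm) AE_iff_measurable[where N = "{t - 2 * d<..t + 2 * d}"])
        (auto simp: trace_measure_def)
    then have "ennreal (?L (t + 2 * d) - ?L (t - 2 * d)) = 0"
      using e by (simp add: trace_measure_def emeasure_stieltjes_measure_Ioc[OF mono_trace] d_def)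
    then have "?L (t + 2 * d) \<le> ?L (t - 2 * d)" by (simp add: ennreal_eq_0_iff)
    moreover have "?L (t - 2 * d) \<le> trace (\<sigma> (t - d))"
      using e by (intro L(3)) (auto simp: d_def)
    moreover have "trace (\<sigma> (t + d)) \<le> ?L (t + 2 * d)"
      using L(2)[of "t + 2 * d"] monoD[OF mono_trace, of "t + d" "t + 2 * d"] e by (simp add: d_def)
    ultimately have "trace (\<sigma> (t + d) - \<sigma> (t - d)) \<le> 0" by (simp add: trace_sub)
    moreover have nn: "nonneg_matrix (\<sigma> (t + d) - \<sigma> (t - d))"
      using e by (intro nonneg_matrix_increment) (simp add: d_def)
    ultimately have "(\<sigma> (t + d) - \<sigma> (t - d)) $ i $ j = 0" for i j
      using nonneg_matrix_entry_le_trace[OF nn, of i j] by auto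
    then have "\<sigma> (t + d) = \<sigma> (t - d)" by (simp add: vec_eq_iff)
    then show False using t e by (auto simp: growth_points_def d_def)
  qed
qed

end

section \<open>The inner product of vector polynomials\<close>

lemma vp_fun_simps:
  "vp_fun (f + g) t = vp_fun f t + vp_fun g t"
  "vp_fun (f - g) t = vp_fun f t - vp_fun g t"
  "vp_fun (P *s f) t = poly P (of_real t) *s vp_fun f t"
  "vp_fun 0 t = 0"
  by (simp_all add: vp_fun_def vec_eq_iff)

lemma vp_fun_measurable: "vp_fun f \<in> borel_measurable borel"
  unfolding vp_fun_def
  by (intro borel_measurable_continuous_onI continuous_on_vec_lambda continuous_intros)

lemma cnj_axis: "cnj (axis i x $ j) = axis i (cnj x) $ j"
  by (simp add: axis_def)

lemma sum_axis:
  fixes f :: "'n::finite \<Rightarrow> 'n \<Rightarrow> complex"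
  shows "(\<Sum>a\<in>UNIV. \<Sum>b\<in>UNIV. axis i x $ a * f a b * axis j y $ b) = x * f i j * y"
proof -
  have "(\<Sum>b\<in>UNIV. axis i x $ a * f a b * axis j y $ b) = (if a = i then x * f a j * y else 0)" for a
    by (simp add: axis_def if_distrib[of "\<lambda>z. _ * z"] cong: if_cong)
  then show ?thesis by simp
qed

section \<open>Vector polynomials with real coefficients\<close>

definition real_vp :: "complex poly ^ 'n \<Rightarrow> bool" where
  "real_vp r \<longleftrightarrow> (\<forall>i k. coeff (r $ i) k \<in> \<real>)"

lemma real_vp_0 [simp]: "real_vp 0"
  by (simp add: real_vp_def)

lemma real_vp_add: "real_vp f \<Longrightarrow> real_vp g \<Longrightarrow> real_vp (f + g)"
  by (simp add: real_vp_def)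

lemma real_vp_diff: "real_vp f \<Longrightarrow> real_vp g \<Longrightarrow> real_vp (f - g)"
  by (simp add: real_vp_def)

lemma real_vp_sum: "(\<And>x. x \<in> A \<Longrightarrow> real_vp (f x)) \<Longrightarrow> real_vp (sum f A)"
  by (induction A rule: infinite_finite_induct) (auto simp: real_vp_add)

lemma real_vp_smult: "a \<in> \<real> \<Longrightarrow> real_vp f \<Longrightarrow> real_vp ([:a:] *s f)"
  by (simp add: real_vp_def)

lemma real_vp_shift: "real_vp f \<Longrightarrow> real_vp ([:0, 1:] *s f)"
  by (simp add: real_vp_def coeff_pCons split: nat.split)

lemma poly_real_coeffs: "(\<And>k. coeff p k \<in> \<real>) \<Longrightarrow> poly p (complex_of_real t) \<in> \<real>"
  by (simp add: poly_altdef)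

locale sigma_matfun =
  fixes \<sigma> :: "('n::{finite,wellorder}) matfun"
  assumes sigma: "\<sigma> \<in> sigma_class"
begin

lemma nondecreasing: "nondecreasing_matrix \<sigma>"
  using sigma by (simp add: sigma_class_def)

definition ip :: "'n vpoly \<Rightarrow> 'n vpoly \<Rightarrow> complex" where
  "ip f g = L2_inner \<sigma> (vp_fun f) (vp_fun g)"

lemma integrable_poly_entry:
  "integrable (trace_measure \<sigma>) (\<lambda>t. poly P (complex_of_real t) * of_real (trace_density \<sigma> t $ i $ j))"
proof -
  have "integrable (trace_measure \<sigma>) (\<lambda>t. of_real (t ^ k * trace_density \<sigma> t $ i $ j) :: complex)" for k
    using sigma by (intro integrable_of_real) (simp add: sigma_class_def moments_exist_def)
  then have "integrable (trace_measure \<sigma>) (\<lambda>t. \<Sum>k\<le>degree P.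
      coeff P k * of_real (t ^ k * trace_density \<sigma> t $ i $ j))"
    by (intro Bochner_Integration.integrable_sum integrable_mult_right)
  then show ?thesis
    by (simp add: poly_altdef sum_distrib_right mult.assoc)
qed

lemma integrable_L2_integrand:
  "integrable (trace_measure \<sigma>) (L2_integrand \<sigma> (vp_fun f) (vp_fun g))"
proof -
  have "cnj (vp_fun f t $ i) * of_real (trace_density \<sigma> t $ i $ j) * vp_fun g t $ j =
    poly (map_poly cnj (f $ i) * g $ j) (of_real t) * of_real (trace_density \<sigma> t $ i $ j)" for t i j
    by (simp add: vp_fun_def)
  then show ?thesis
    unfolding L2_integrand_def by (intro Bochner_Integration.integrable_sum) (simp only: integrable_poly_entry)
qed

lemma vp_fun_in_L2_space: "vp_fun f \<in> L2_space \<sigma>"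
  by (simp add: L2_space_def vp_fun_measurable integrable_L2_integrand)

lemma ip_add_right: "ip f (g + h) = ip f g + ip f h"
proof -
  have "L2_integrand \<sigma> (vp_fun f) (vp_fun (g + h)) =
    (\<lambda>t. L2_integrand \<sigma> (vp_fun f) (vp_fun g) t + L2_integrand \<sigma> (vp_fun f) (vp_fun h) t)"
    by (simp add: L2_integrand_def vp_fun_simps ring_distribs sum.distrib fun_eq_iff)
  then show ?thesis
    by (simp add: ip_def L2_inner_def integrable_L2_integrand)
qed

lemma ip_smult_right: "ip f ([:a:] *s g) = a * ip f g"
proof -
  have "L2_integrand \<sigma> (vp_fun f) (vp_fun ([:a:] *s g)) =
    (\<lambda>t. a * L2_integrand \<sigma> (vp_fun f) (vp_fun g) t)"
    by (simp add: L2_integrand_def vp_fun_simps sum_distrib_left fun_eq_iff mult_ac)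
  then show ?thesis
    by (simp add: ip_def L2_inner_def integrable_L2_integrand)
qed

lemma ip_cnj: "cnj (ip f g) = ip g f"
proof -
  have "cnj (L2_integrand \<sigma> (vp_fun f) (vp_fun g) t) = L2_integrand \<sigma> (vp_fun g) (vp_fun f) t" for t
    unfolding L2_integrand_def
    by (subst sum.swap) (simp add: trace_density_sym[OF nondecreasing, of t] mult_ac)
  then have "L2_integrand \<sigma> (vp_fun g) (vp_fun f) = (\<lambda>t. cnj (L2_integrand \<sigma> (vp_fun f) (vp_fun g) t))"
    by (simp add: fun_eq_iff)
  then show ?thesis by (simp add: ip_def L2_inner_def)
qed

text \<open>The integration variable is real, so conjugation does not affect the factor z.\<close>

lemma ip_shift: "ip f ([:0, 1:] *s g) = ip ([:0, 1:] *s f) g"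
proof -
  have "L2_integrand \<sigma> (vp_fun f) (vp_fun ([:0, 1:] *s g)) =
    L2_integrand \<sigma> (vp_fun ([:0, 1:] *s f)) (vp_fun g)"
    by (simp add: L2_integrand_def vp_fun_simps fun_eq_iff mult_ac)
  then show ?thesis by (simp add: ip_def L2_inner_def)
qed

lemma ip_real:
  assumes "real_vp f" "real_vp g"
  shows "ip f g \<in> \<real>"
proof -
  have "L2_integrand \<sigma> (vp_fun f) (vp_fun g) t \<in> \<real>" for t
    using assms poly_real_coeffs[of "f $ _" t] poly_real_coeffs[of "g $ _" t]
    unfolding L2_integrand_def real_vp_def vp_fun_def
    by (intro sum_in_Reals Reals_mult) (auto simp: Reals_cnj_iff)
  then have "Im (L2_integrand \<sigma> (vp_fun f) (vp_fun g) t) = 0" for t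
    by (simp add: complex_is_Real_iff)
  then show ?thesis
    using integral_Im[OF integrable_L2_integrand, of f g]
    by (simp add: ip_def L2_inner_def complex_is_Real_iff)
qed

lemma ip_self_nonneg: "0 \<le> Re (ip f f)"
proof -
  have "AE t in trace_measure \<sigma>. 0 \<le> Re (L2_integrand \<sigma> (vp_fun f) (vp_fun f) t)"
    using trace_density_nonneg[OF nondecreasing]
  proof eventually_elim
    case (elim t)
    \<comment> \<open>The density is real, so the real part of the integrand splits into its
      quadratic forms at the real and the imaginary part of the vector.\<close>
    define a b where "a = (\<chi> i. Re (vp_fun f t $ i))" and "b = (\<chi> i. Im (vp_fun f t $ i))"
    have "Re (L2_integrand \<sigma> (vp_fun f) (vp_fun f) t) =
      a \<bullet> (trace_density \<sigma> t *v a) + b \<bullet> (trace_density \<sigma> t *v b)"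
      unfolding quadratic_form_eq_sum L2_integrand_def
      by (simp add: a_def b_def algebra_simps sum.distrib)
    then show ?case using elim by simp
  qed
  then have "0 \<le> (\<integral>t. Re (L2_integrand \<sigma> (vp_fun f) (vp_fun f) t) \<partial>trace_measure \<sigma>)"
    by (rule integral_nonneg_AE)
  then show ?thesis
    by (simp add: ip_def L2_inner_def integral_Re[OF integrable_L2_integrand])
qed

lemma ip_add_left: "ip (f + g) h = ip f h + ip g h"
  by (metis ip_add_right ip_cnj complex_cnj_add)

lemma ip_smult_left: "ip ([:a:] *s f) g = cnj a * ip f g"
  by (metis ip_smult_right ip_cnj complex_cnj_mult)

lemma ip_0_right [simp]: "ip f 0 = 0"
  using ip_smult_right[of f 0 0] by simp

lemma ip_0_left [simp]: "ip 0 f = 0"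
  using ip_smult_left[of 0 0 f] by simp

lemma ip_diff_right: "ip f (g - h) = ip f g - ip f h"
  using ip_add_right[of f "g - h" h] by simp

lemma ip_diff_left: "ip (f - g) h = ip f h - ip g h"
  using ip_add_left[of "f - g" g h] by simp

lemma ip_sum_right: "ip f (sum g A) = (\<Sum>x\<in>A. ip f (g x))"
  by (induction A rule: infinite_finite_induct) (auto simp: ip_add_right)

lemma Im_ip_self [simp]: "Im (ip f f) = 0"
  using ip_cnj[of f f] by (simp add: complex_eq_iff)

lemma ip_self_eq_of_real: "ip f f = of_real (Re (ip f f))"
  by (simp add: complex_eq_iff)

section \<open>Null vector polynomials form a module over the scalar polynomials\<close>

definition nul :: "'n vpoly \<Rightarrow> bool" where
  "nul r \<longleftrightarrow> ip r r = 0"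

lemma L2_norm_vp: "L2_norm \<sigma> (vp_fun f) = sqrt (Re (ip f f))"
  by (simp add: L2_norm_def ip_def)

lemma L2_norm_eq_0_iff: "L2_norm \<sigma> (vp_fun f) = 0 \<longleftrightarrow> nul f"
  by (simp add: L2_norm_vp nul_def complex_eq_iff)

text \<open>The degenerate case of the Cauchy-Schwarz inequality: otherwise adding a multiple of
  \<open>r\<close> to \<open>f\<close> would make the squared norm negative.\<close>

lemma nul_ip_right:
  assumes "nul r"
  shows "ip f r = 0"
proof (rule ccontr)
  assume "ip f r \<noteq> 0"
  define u where "u = ip f r"
  \<comment> \<open>Chosen so that the squared norm of \<open>f + [:s:] *s r\<close> becomes exactly
    -1.\<close>
  define x where "x = - (Re (ip f f) + 1) / (2 * (cmod u)\<^sup>2)"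
  define s where "s = of_real x * cnj u"
  have r: "ip r r = 0" "ip r f = cnj u" using assms by (simp_all add: nul_def u_def ip_cnj)
  have "0 \<le> Re (ip (f + [:s:] *s r) (f + [:s:] *s r))" by (rule ip_self_nonneg)
  also have "ip (f + [:s:] *s r) (f + [:s:] *s r) = ip f f + of_real (2 * x * (cmod u)\<^sup>2)"
    by (simp add: ip_add_left ip_add_right ip_smult_left ip_smult_right r u_def[symmetric] s_def
        complex_norm_square[of u, unfolded of_real_power] algebra_simps)
  also have "2 * x * (cmod u)\<^sup>2 = - (Re (ip f f) + 1)"
    using \<open>ip f r \<noteq> 0\<close> by (simp add: x_def u_def[symmetric] divide_simps)
  also have "Re (ip f f + of_real (- (Re (ip f f) + 1))) = -1" by simp
  finally show False by simp
qed

lemma nul_ip_left: "nul r \<Longrightarrow> ip r f = 0"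
  using nul_ip_right[of r f] ip_cnj[of f r] by simp

lemma nul_0 [simp]: "nul 0"
  by (simp add: nul_def)

lemma nul_add: "nul f \<Longrightarrow> nul g \<Longrightarrow> nul (f + g)"
  by (simp add: nul_def[of "f + g"] ip_add_left nul_ip_left)

lemma nul_diff: "nul f \<Longrightarrow> nul g \<Longrightarrow> nul (f - g)"
  by (simp add: nul_def[of "f - g"] ip_diff_left nul_ip_left)

lemma nul_smult: "nul f \<Longrightarrow> nul ([:a:] *s f)"
  by (simp add: nul_def ip_smult_left ip_smult_right)

lemma nul_sum: "(\<And>x. x \<in> A \<Longrightarrow> nul (f x)) \<Longrightarrow> nul (sum f A)"
  by (induction A rule: infinite_finite_induct) (auto simp: nul_add)

text \<open>Symmetry moves one factor z across: the squared norm of \<open>z f\<close> is the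
  product of \<open>f\<close> with \<open>z z f\<close>, and \<open>f\<close> is orthogonal to
  everything.\<close>

lemma nul_shift: "nul f \<Longrightarrow> nul ([:0, 1:] *s f)"
  by (simp add: nul_def[of "[:0, 1:] *s f"] ip_shift[symmetric] nul_ip_left)

lemma nul_poly_smult: "nul f \<Longrightarrow> nul (P *s f)"
proof (induction P)
  case (pCons a P)
  have eq: "pCons a P *s f = [:a:] *s f + [:0, 1:] *s (P *s f)"
    by (simp add: vec_eq_iff algebra_simps)
  show ?case unfolding eq using pCons by (intro nul_add nul_smult nul_shift) auto
qed simp

lemma ip_axis: "ip (axis i 1) (axis j 1) = of_real (moment \<sigma> 0 $ i $ j)"
proof -
  have "L2_integrand \<sigma> (vp_fun (axis i 1)) (vp_fun (axis j 1)) t = of_real (trace_density \<sigma> t $ i $ j)" for t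
  proof -
    have *: "vp_fun (axis i 1) t = axis i 1" for i
      by (simp add: vp_fun_def vec_eq_iff axis_def)
    show ?thesis unfolding L2_integrand_def * cnj_axis sum_axis by simp
  qed
  then have "L2_integrand \<sigma> (vp_fun (axis i 1)) (vp_fun (axis j 1)) =
      (\<lambda>t. of_real (trace_density \<sigma> t $ i $ j))"
    by (simp add: fun_eq_iff)
  then show ?thesis by (simp add: ip_def L2_inner_def moment_def)
qed

text \<open>The integral of the nonnegative function \<open>?g i\<close> vanishes, so it is zero
  almost everywhere. Summing over \<open>i\<close> leaves the squared modulus of \<open>P\<close>,
  because the density has trace 1.\<close>

lemma poly_zero_AE:
  assumes "\<And>i. nul (P *s axis i 1)"
  shows "AE t in trace_measure \<sigma>. poly P (of_real t) = 0"
proof -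
  let ?D = "trace_density \<sigma>"
  let ?g = "\<lambda>i t. (cmod (poly P (of_real t)))\<^sup>2 * ?D t $ i $ i"
  have L2: "L2_integrand \<sigma> (vp_fun (P *s axis i 1)) (vp_fun (P *s axis i 1)) = (\<lambda>t. of_real (?g i t))" for i
  proof
    fix t
    have *: "vp_fun (P *s axis i 1) t = axis i (poly P (of_real t))"
      by (simp add: vp_fun_def vec_eq_iff axis_def)
    show "L2_integrand \<sigma> (vp_fun (P *s axis i 1)) (vp_fun (P *s axis i 1)) t = of_real (?g i t)"
      unfolding L2_integrand_def * cnj_axis sum_axis
      by (simp add: complex_norm_square mult_ac del: of_real_power)
  qed
  have int: "integrable (trace_measure \<sigma>) (?g i)" for i
    using integrable_Re[OF integrable_L2_integrand[of "P *s axis i 1" "P *s axis i 1"]] unfolding L2 by simp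
  have zero: "integral\<^sup>L (trace_measure \<sigma>) (?g i) = 0" for i
    using assms[of i] unfolding nul_def ip_def L2_inner_def L2 integral_complex_of_real by simp
  have nn: "AE t in trace_measure \<sigma>. 0 \<le> ?g i t" for i
    using trace_density_nonneg[OF nondecreasing]
  proof eventually_elim
    case (elim t)
    then show ?case
      using spec[OF elim, of "axis i 1"] by (simp add: matrix_vector_mult_basis column_def inner_axis')
  qed
  have "AE t in trace_measure \<sigma>. \<forall>i\<in>UNIV. ?g i t = 0"
    using integral_nonneg_eq_0_iff_AE[OF int nn] zero by (intro AE_finite_allI) auto
  with trace_density_trace[OF nondecreasing] show ?thesis
  proof eventually_elim
    case (elim t)
    have "(cmod (poly P (of_real t)))\<^sup>2 * (\<Sum>i\<in>UNIV. ?D t $ i $ i) = 0"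
      unfolding sum_distrib_left using elim(2) by (intro sum.neutral) auto
    then show ?case using elim(1) by simp
  qed
qed

text \<open>Otherwise the trace measure would be concentrated on the finitely many real zeros of
  \<open>P\<close>, which would contain all growth points.\<close>

lemma poly_eq_0_if_nul:
  assumes "\<And>i. nul (P *s axis i 1)"
  shows "P = 0"
proof (rule ccontr)
  assume "P \<noteq> 0"
  then have "finite {z. poly P z = 0}" by (rule poly_roots_finite)
  then have "finite {t. poly P (of_real t) = 0}"
    using finite_vimageI[of "{z. poly P z = 0}" complex_of_real] by (simp add: vimage_def inj_def)
  moreover have "growth_points \<sigma> \<subseteq> {t. poly P (of_real t) = 0}"
    using poly_zero_AE[OF assms] calculation
    by (intro growth_points_subset[OF nondecreasing]) auto
  ultimately show False
    using sigma finite_subset by (auto simp: sigma_class_def)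
qed

end

section \<open>Heights and the Gram-Schmidt procedure\<close>

lemma pos_less_iff: "pos i < pos j \<longleftrightarrow> i < (j :: 'n::{finite,wellorder})"
proof -
  have *: "pos i < pos j" if "i < j" for i j :: 'n
    unfolding pos_def using that by (intro psubset_card_mono) auto
  then show ?thesis by (metis less_asym less_linear)
qed

lemma inj_pos: "inj (pos :: 'n::{finite,wellorder} \<Rightarrow> nat)"
  by (rule injI) (metis pos_less_iff less_irrefl less_linear)

lemma pos_less_card: "pos (i :: 'n::{finite,wellorder}) < CARD('n)"
  unfolding pos_def by (intro psubset_card_mono) auto

lemma range_pos: "range (pos :: 'n::{finite,wellorder} \<Rightarrow> nat) = {..<CARD('n)}"
  using pos_less_card by (intro card_subset_eq) (auto simp: card_image[OF inj_pos])

section \<open>Coordinates of vector polynomials ordered by height\<close>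

text \<open>\<open>cf r x\<close> is the coefficient of \<open>unit_vp (x + 1)\<close>, the vector of height \<open>x\<close>, in \<open>r\<close>;
  \<open>hlt r N\<close> says that the height of \<open>r\<close> is less than \<open>N\<close>.\<close>

definition cf :: "('n::{finite,wellorder}) vpoly \<Rightarrow> nat \<Rightarrow> complex" where
  "cf r x = coeff (r $ inv_into UNIV pos (x mod CARD('n))) (x div CARD('n))"

definition hlt :: "('n::{finite,wellorder}) vpoly \<Rightarrow> nat \<Rightarrow> bool" where
  "hlt r N \<longleftrightarrow> (\<forall>x\<ge>N. cf r x = 0)"

lemma pos_inv_mod: "pos (inv_into UNIV pos (x mod CARD('n)) :: 'n::{finite,wellorder}) = x mod CARD('n)"
  by (rule f_inv_into_f) (simp add: range_pos)

lemma cf_pos: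
  fixes r :: "('n::{finite,wellorder}) vpoly"
  shows "cf r (CARD('n) * d + pos j) = coeff (r $ j) d"
  using pos_less_card[of j] by (simp add: cf_def inv_into_f_f[OF inj_pos])

lemma vpoly_eqI:
  fixes f g :: "('n::{finite,wellorder}) vpoly"
  assumes "\<And>x. cf f x = cf g x"
  shows "f = g"
  using assms by (metis cf_pos poly_eqI vec_eq_iff)

lemma cf_linear [simp]:
  "cf 0 x = 0" "cf (f + g) x = cf f x + cf g x" "cf (f - g) x = cf f x - cf g x"
  "cf ([:a:] *s f) x = a * cf f x"
  by (simp_all add: cf_def)

lemma cf_sum: "cf (sum f A) x = (\<Sum>a\<in>A. cf (f a) x)"
  by (induction A rule: infinite_finite_induct) auto

lemma cf_unit_vp: "cf (unit_vp (Suc k) :: ('n::{finite,wellorder}) vpoly) x = of_bool (x = k)"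
proof -
  have "x = k \<longleftrightarrow> k mod CARD('n) = x mod CARD('n) \<and> k div CARD('n) = x div CARD('n)"
    by (metis div_mult_mod_eq)
  then show ?thesis by (auto simp: cf_def unit_vp_def pos_inv_mod)
qed

lemma cf_monom_smult:
  fixes r :: "('n::{finite,wellorder}) vpoly"
  shows "cf (monom 1 l *s r) x = (if x < CARD('n) * l then 0 else cf r (x - CARD('n) * l))"
proof (cases "x < CARD('n) * l")
  case True
  then have "x div CARD('n) < l" by (simp add: div_less_iff_less_mult mult.commute)
  with True show ?thesis by (simp add: cf_def coeff_monom_mult)
next
  case False
  then obtain y where "x = y + CARD('n) * l" by (metis le_add_diff_inverse2 not_less)
  then show ?thesis by (simp add: cf_def coeff_monom_mult)
qed

lemma cf_shift:
  fixes r :: "('n::{finite,wellorder}) vpoly"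
  shows "cf ([:0, 1:] *s r) x = (if x < CARD('n) then 0 else cf r (x - CARD('n)))"
proof -
  have "[:0, 1:] = monom (1 :: complex) 1" by (simp add: monom_altdef)
  then show ?thesis using cf_monom_smult[of 1 r x] by simp
qed

lemma hlt_exists:
  fixes r :: "('n::{finite,wellorder}) vpoly"
  shows "\<exists>N. hlt r N"
proof -
  define d where "d = (\<Sum>i\<in>UNIV. Suc (degree (r $ i)))"
  have d: "degree (r $ i) < d" for i
    using member_le_sum[of i UNIV "\<lambda>i. Suc (degree (r $ i))"] by (simp add: d_def)
  have "cf r x = 0" if "x \<ge> d * CARD('n)" for x
  proof -
    have "d \<le> x div CARD('n)" using that by (simp add: less_eq_div_iff_mult_less_eq)
    then show ?thesis using d unfolding cf_def by (meson coeff_eq_0 less_le_trans)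
  qed
  then show ?thesis by (auto simp: hlt_def)
qed

lemma hlt_0_iff: "hlt r 0 \<longleftrightarrow> r = 0"
  by (auto simp: hlt_def intro: vpoly_eqI)

lemma hlt_mono: "hlt r M \<Longrightarrow> M \<le> N \<Longrightarrow> hlt r N"
  by (auto simp: hlt_def)

text \<open>The maximum is attained in the component whose position is x modulo n, and the degree
  there is the quotient of x by n.\<close>

lemma height_eqI:
  fixes r :: "('n::{finite,wellorder}) vpoly"
  assumes "cf r x \<noteq> 0" "hlt r (Suc x)"
  shows "height r = ereal (real x)"
  unfolding height_def
proof (rule Max_eqI)
  let ?i = "inv_into UNIV pos (x mod CARD('n)) :: 'n"
  have x: "x = CARD('n) * (x div CARD('n)) + pos ?i" by (simp add: pos_inv_mod)
  have le: "CARD('n) * degree (r $ j) + pos j \<le> x" if "r $ j \<noteq> 0" for j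
  proof (rule ccontr)
    assume "\<not> ?thesis"
    then have "coeff (r $ j) (degree (r $ j)) = 0"
      using assms(2) by (simp add: hlt_def flip: cf_pos)
    then show False using that by simp
  qed
  fix y assume "y \<in> range (\<lambda>j. if r $ j = 0 then - \<infinity> else ereal (real (CARD('n) * degree (r $ j) + pos j)))"
  then show "y \<le> ereal (real x)"
    using le by (auto split: if_splits simp del: of_nat_add of_nat_mult)
next
  let ?i = "inv_into UNIV pos (x mod CARD('n)) :: 'n"
  have c: "coeff (r $ ?i) (x div CARD('n)) \<noteq> 0" using assms(1) by (simp add: cf_def)
  have "degree (r $ ?i) \<le> x div CARD('n)"
  proof (rule degree_le, safe)
    fix d assume d: "d > x div CARD('n)"
    have "x < CARD('n) * d" using d by (simp add: div_less_iff_less_mult mult.commute)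
    then show "coeff (r $ ?i) d = 0"
      using assms(2) unfolding hlt_def cf_pos[symmetric] by auto
  qed
  then have "degree (r $ ?i) = x div CARD('n)" using c le_degree[OF c] by simp
  then show "ereal (real x) \<in> range (\<lambda>j. if r $ j = 0 then - \<infinity> else ereal (real (CARD('n) * degree (r $ j) + pos j)))"
    using c by (intro image_eqI[of _ _ ?i]) (auto simp: pos_inv_mod)
qed simp

lemma real_vp_unit_vp: "real_vp (unit_vp k)"
  by (simp add: real_vp_def unit_vp_def)

lemma cf_real: "real_vp r \<Longrightarrow> cf r x \<in> \<real>"
  by (simp add: cf_def real_vp_def)

text \<open>The degree bound keeps the induction going: two solutions of different degrees have a nonzero
  combination that one further functional kills.\<close>

lemma common_kernel_poly:
  fixes \<phi> :: "'a \<Rightarrow> complex poly \<Rightarrow> complex"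
  assumes "finite A"
    and add: "\<And>a p q. \<phi> a (p + q) = \<phi> a p + \<phi> a q"
    and smult: "\<And>a c p. \<phi> a (smult c p) = c * \<phi> a p"
  shows "\<exists>p. p \<noteq> 0 \<and> d \<le> degree p \<and> (\<forall>a\<in>A. \<phi> a p = 0)"
  using assms(1)
proof (induction A arbitrary: d rule: finite_induct)
  case empty
  show ?case by (intro exI[of _ "monom 1 d"]) (simp add: degree_monom_eq)
next
  case (insert b A)
  obtain p where p: "p \<noteq> 0" "d \<le> degree p" "\<forall>a\<in>A. \<phi> a p = 0" using insert.IH by blast
  obtain q where q: "q \<noteq> 0" "Suc (degree p) \<le> degree q" "\<forall>a\<in>A. \<phi> a q = 0" using insert.IH by blast
  show ?case
  proof (cases "\<phi> b p = 0")
    case True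
    then show ?thesis using p by auto
  next
    case False
    let ?r = "smult (- \<phi> b q) p + smult (\<phi> b p) q"
    have "degree ?r = degree (smult (\<phi> b p) q)"
      using False q(2) by (intro degree_add_eq_right) (auto intro: le_less_trans[OF degree_smult_le])
    then have "degree ?r = degree q" using False by simp
    then have "?r \<noteq> 0" "d \<le> degree ?r" using p(2) q(2) by auto
    moreover have "\<phi> a ?r = - \<phi> b q * \<phi> a p + \<phi> b p * \<phi> a q" for a
      by (simp only: add smult)
    then have "\<forall>a\<in>insert b A. \<phi> a ?r = 0" using p(3) q(3) by auto
    ultimately show ?thesis by blast
  qed
qed

section \<open>The procedure indexed by heights\<close>

context sigma_matfun
begin

text \<open>Steps are labelled by the height \<open>x\<close> of the vector processed, so \<open>x\<close> stands for step
  \<open>x + 1\<close>; \<open>isP x\<close> and \<open>isQ x\<close> say that it yields an orthonormal or a null polynomial.\<close>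

definition skip :: "nat \<Rightarrow> bool" where
  "skip x \<longleftrightarrow> (\<exists>q\<in>set (snd (gs \<sigma> x)). \<exists>l\<ge>1. ereal (real x) = height q + ereal (real (CARD('n) * l)))"

definition ph :: "nat \<Rightarrow> 'n vpoly" where
  "ph x = unit_vp (Suc x) - (\<Sum>p\<leftarrow>fst (gs \<sigma> x). [:ip p (unit_vp (Suc x)):] *s p)"

definition nrm :: "nat \<Rightarrow> real" where
  "nrm x = L2_norm \<sigma> (vp_fun (ph x))"

definition pp :: "nat \<Rightarrow> 'n vpoly" where
  "pp x = [:complex_of_real (1 / nrm x):] *s ph x"

definition isQ :: "nat \<Rightarrow> bool" where
  "isQ x \<longleftrightarrow> \<not> skip x \<and> nul (ph x)"

definition isP :: "nat \<Rightarrow> bool" where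
  "isP x \<longleftrightarrow> \<not> skip x \<and> \<not> nul (ph x)"

definition Ps :: "nat \<Rightarrow> nat set" where
  "Ps x = {y. y < x \<and> isP y}"

lemma finite_Ps [simp]: "finite (Ps x)"
  by (simp add: Ps_def)

text \<open>Recovers the accumulated lists from \<open>isP\<close> and \<open>isQ\<close>, so that
  the later arguments deal with heights instead of list positions.\<close>

lemma gs_eq: "gs \<sigma> N = (map pp (filter isP [0..<N]), map ph (filter isQ [0..<N]))"
proof (induction N)
  case (Suc N)
  obtain ps qs where pq: "gs \<sigma> N = (ps, qs)" by (cases "gs \<sigma> N")
  have "gs \<sigma> (Suc N) = (if skip N then (ps, qs) else if nul (ph N) then (ps, qs @ [ph N])
      else (ps @ [pp N], qs))"
    by (simp add: pq Let_def skip_def L2_norm_eq_0_iff[symmetric] ph_def ip_def pp_def nrm_def)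
  then show ?case using Suc.IH pq by (auto simp: isP_def isQ_def)
qed simp

lemma ph_eq: "ph x = unit_vp (Suc x) - (\<Sum>y\<in>Ps x. [:ip (pp y) (unit_vp (Suc x)):] *s pp y)"
proof -
  have "(\<Sum>p\<leftarrow>fst (gs \<sigma> x). [:ip p (unit_vp (Suc x)):] *s p) =
    sum_list (map (\<lambda>y. [:ip (pp y) (unit_vp (Suc x)):] *s pp y) (filter isP [0..<x]))"
    by (simp add: gs_eq o_def)
  also have "\<dots> = sum (\<lambda>y. [:ip (pp y) (unit_vp (Suc x)):] *s pp y) (set (filter isP [0..<x]))"
    by (rule sum_list_distinct_conv_sum_set) simp
  also have "set (filter isP [0..<x]) = Ps x" by (auto simp: Ps_def)
  finally show ?thesis by (simp add: ph_def)
qed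

text \<open>Only polynomials of smaller height are subtracted from the unit vector, so its leading
  coefficient 1 survives.\<close>

lemma cf_ph: "x \<le> y \<Longrightarrow> cf (ph x) y = of_bool (y = x)"
proof (induction x arbitrary: y rule: less_induct)
  case (less x)
  have "cf (pp z) y = 0" if "z \<in> Ps x" for z
    using that less by (simp add: pp_def Ps_def)
  then have "(\<Sum>z\<in>Ps x. ip (pp z) (unit_vp (Suc x)) * cf (pp z) y) = 0" by simp
  then show ?case by (subst ph_eq) (simp add: cf_sum cf_unit_vp)
qed

lemma hlt_ph: "hlt (ph x) (Suc x)"
  by (simp add: hlt_def cf_ph)

lemma hlt_pp: "hlt (pp x) (Suc x)"
  by (simp add: hlt_def cf_ph pp_def)

lemma cf_pp: "cf (pp x) x = of_real (1 / nrm x)"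
  by (simp add: cf_ph pp_def)

lemma height_ph: "height (ph x) = ereal (real x)"
  by (rule height_eqI) (simp_all add: cf_ph hlt_ph)

lemma real_vp_ph: "real_vp (ph x)"
proof (induction x rule: less_induct)
  case (less x)
  have pp: "real_vp (pp y)" if "y \<in> Ps x" for y
    unfolding pp_def using that less by (intro real_vp_smult) (auto simp: Ps_def)
  show ?case
    by (subst ph_eq) (intro real_vp_diff real_vp_unit_vp real_vp_sum real_vp_smult ip_real pp)
qed

lemma real_vp_pp: "real_vp (pp x)"
  unfolding pp_def by (intro real_vp_smult real_vp_ph) auto

lemma nrm_pos: "isP x \<Longrightarrow> 0 < nrm x"
  using ip_self_nonneg[of "ph x"] L2_norm_eq_0_iff[of "ph x"]
  by (auto simp: nrm_def L2_norm_vp isP_def less_le)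

lemma ip_ph_self: "ip (ph x) (ph x) = of_real ((nrm x)\<^sup>2)"
  using ip_self_nonneg[of "ph x"] by (simp add: nrm_def L2_norm_vp ip_self_eq_of_real[symmetric])

lemma ip_pp_self: "isP x \<Longrightarrow> ip (pp x) (pp x) = 1"
  using nrm_pos[of x] by (simp add: pp_def ip_smult_left ip_smult_right ip_ph_self power2_eq_square)

lemma ip_pp_ph: "y < x \<Longrightarrow> isP y \<Longrightarrow> ip (pp y) (ph x) = 0"
proof (induction x arbitrary: y rule: less_induct)
  case (less x)
  have lt: "ip (pp y) (pp z) = 0" if "y < z" "z < x" "isP y" for y z
    using less.IH[OF that(2,1,3)] by (simp add: pp_def[of z] ip_smult_right)
  have "ip (pp y) (pp z) = of_bool (y = z)" if "z \<in> Ps x" for z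
    using lt[of y z] lt[of z y] ip_cnj[of "pp z" "pp y"] that less.prems ip_pp_self[of y]
    by (cases y z rule: linorder_cases) (auto simp: Ps_def)
  then have "ip (pp y) (ph x) =
      ip (pp y) (unit_vp (Suc x)) - (\<Sum>z\<in>Ps x. ip (pp z) (unit_vp (Suc x)) * of_bool (y = z))"
    by (subst ph_eq) (simp add: ip_diff_right ip_sum_right ip_smult_right cong: sum.cong)
  also have "(\<Sum>z\<in>Ps x. ip (pp z) (unit_vp (Suc x)) * of_bool (y = z)) = ip (pp y) (unit_vp (Suc x))"
    using less.prems by (simp add: of_bool_def if_distrib[of "\<lambda>x. _ * x"] Ps_def cong: if_cong)
  finally show ?case by simp
qed

lemma ip_pp: "isP x \<Longrightarrow> isP y \<Longrightarrow> ip (pp x) (pp y) = of_bool (x = y)"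
  using ip_pp_ph[of x y] ip_pp_ph[of y x] ip_cnj[of "pp y" "pp x"] ip_pp_self[of x]
  by (cases x y rule: linorder_cases) (auto simp: pp_def[of y] pp_def[of x] ip_smult_right ip_smult_left)

lemma skip_iff: "skip x \<longleftrightarrow> (\<exists>y l. isQ y \<and> l \<ge> 1 \<and> x = y + CARD('n) * l)"
proof -
  have "skip x \<longleftrightarrow> (\<exists>y. y < x \<and> isQ y \<and> (\<exists>l\<ge>1. ereal (real x) = height (ph y) + ereal (real (CARD('n) * l))))"
    by (auto simp: skip_def gs_eq)
  also have "\<dots> \<longleftrightarrow> (\<exists>y l. y < x \<and> isQ y \<and> l \<ge> 1 \<and> x = y + CARD('n) * l)"
    by (auto simp: height_ph simp flip: of_nat_add of_nat_mult)
  also have "\<dots> \<longleftrightarrow> (\<exists>y l. isQ y \<and> l \<ge> 1 \<and> x = y + CARD('n) * l)"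
  proof -
    have "y < x" if "l \<ge> 1" "x = y + CARD('n) * l" for y l using that by simp
    then show ?thesis by blast
  qed
  finally show ?thesis .
qed

text \<open>A height without orthonormal polynomial is either null, the case \<open>l = 0\<close>,
  or skipped, the case \<open>l \<ge> 1\<close>.\<close>

lemma isP_iff: "isP x \<longleftrightarrow> (\<forall>y l. isQ y \<longrightarrow> x \<noteq> y + CARD('n) * l)"
proof -
  have "\<not> isP x \<longleftrightarrow> isQ x \<or> skip x" by (auto simp: isP_def isQ_def)
  also have "\<dots> \<longleftrightarrow> (\<exists>y l. isQ y \<and> x = y + CARD('n) * l)"
    unfolding skip_iff
  proof safe
    assume "isQ x"
    then show "\<exists>y l. isQ y \<and> x = y + CARD('n) * l" by (intro exI[of _ x] exI[of _ 0]) simp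
  next
    fix y l assume "isQ y" and *: "\<nexists>ya la. isQ ya \<and> 1 \<le> la \<and> y + CARD('n) * l = ya + CARD('n) * la"
    then have "l = 0" by (metis less_one not_le)
    then show "isQ (y + CARD('n) * l)" using \<open>isQ y\<close> by simp
  qed auto
  finally show ?thesis by blast
qed

lemma isQ_not_skip: "isQ x \<Longrightarrow> isQ y \<Longrightarrow> y = x + CARD('n) * l \<Longrightarrow> l = 0"
  using skip_iff[of y] unfolding isQ_def[of y] by (metis less_one not_le)

text \<open>Of two distinct congruent null heights the larger would have been skipped.\<close>

lemma isQ_mod_inj: "isQ x \<Longrightarrow> isQ y \<Longrightarrow> x mod CARD('n) = y mod CARD('n) \<Longrightarrow> x = y"
proof (induction x y rule: linorder_wlog)
  case (le x y)
  obtain l where "y = x + CARD('n) * l"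
    using le mod_eq_iff_dvd_symdiff_nat[of x "CARD('n)" y] by (metis dvdE le_add_diff_inverse mod_eq_dvd_iff_nat)
  then show ?case using isQ_not_skip[OF le(2,3)] by simp
qed auto

text \<open>By induction on the height bound, the leading term is removed either by a multiple of
  \<open>pp\<close> of that height or, if there is none, by a null vector
  \<open>monom 1 l *s ph y\<close>.\<close>

lemma span:
  assumes "hlt r N"
  shows "nul (r - (\<Sum>y\<in>Ps N. [:ip (pp y) r:] *s pp y))"
proof -
  have "\<exists>a. nul (r - (\<Sum>y\<in>Ps N. [:a y:] *s pp y))"
    using assms
  proof (induction N arbitrary: r)
    case 0
    then have "r = 0" by (simp add: hlt_0_iff)
    then show ?case by (auto simp: Ps_def)
  next
    case (Suc N)
    show ?case
    proof (cases "isP N")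
      case True
      have Ps: "Ps (Suc N) = insert N (Ps N)" "N \<notin> Ps N"
        using True by (auto simp: Ps_def less_Suc_eq)
      define r' where "r' = r - [:cf r N:] *s ph N"
      have "hlt r' N"
        using Suc.prems by (auto simp: hlt_def r'_def cf_ph Suc_le_eq)
      then obtain a where a: "nul (r' - (\<Sum>y\<in>Ps N. [:a y:] *s pp y))" using Suc.IH by blast
      \<comment> \<open>\<open>pp N\<close> is \<open>ph N\<close> divided by \<open>nrm N\<close>,
        so the coefficient is multiplied by that norm.\<close>
      define b where "b = a(N := cf r N * of_real (nrm N))"
      have "[:b N:] *s pp N = [:cf r N:] *s ph N"
        using nrm_pos[OF True] by (simp add: b_def pp_def)
      moreover have "(\<Sum>y\<in>Ps N. [:b y:] *s pp y) = (\<Sum>y\<in>Ps N. [:a y:] *s pp y)"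
        using Ps(2) by (intro sum.cong) (auto simp: b_def)
      ultimately have "r - (\<Sum>y\<in>Ps (Suc N). [:b y:] *s pp y) = r' - (\<Sum>y\<in>Ps N. [:a y:] *s pp y)"
        by (simp only: Ps(1) sum.insert[OF finite_Ps Ps(2)] r'_def diff_diff_eq)
      then have "nul (r - (\<Sum>y\<in>Ps (Suc N). [:b y:] *s pp y))" using a by (simp only:)
      then show ?thesis by (rule exI[of _ b])
    next
      case False
      then have Ps: "Ps (Suc N) = Ps N" by (auto simp: Ps_def less_Suc_eq)
      obtain y l where y: "isQ y" "N = y + CARD('n) * l" using False isP_iff by auto
      \<comment> \<open>A null vector of height \<open>N\<close> with leading coefficient 1.\<close>
      define u where "u = monom 1 l *s ph y"
      have "nul u" using y(1) by (simp add: u_def isQ_def nul_poly_smult)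
      define r' where "r' = r - [:cf r N:] *s u"
      have "cf u x = of_bool (x = N)" if "x \<ge> N" for x
        using that y(2) by (auto simp: u_def cf_monom_smult cf_ph)
      then have "hlt r' N"
        using Suc.prems by (auto simp: hlt_def r'_def Suc_le_eq)
      then obtain a where a: "nul (r' - (\<Sum>y\<in>Ps N. [:a y:] *s pp y))" using Suc.IH by blast
      have "r - (\<Sum>y\<in>Ps (Suc N). [:a y:] *s pp y) =
          (r' - (\<Sum>y\<in>Ps N. [:a y:] *s pp y)) + [:cf r N:] *s u"
        unfolding Ps r'_def by (simp only: algebra_simps)
      then have "nul (r - (\<Sum>y\<in>Ps (Suc N). [:a y:] *s pp y))"
        using nul_add[OF a nul_smult[OF \<open>nul u\<close>]] by (simp only:)
      then show ?thesis by (rule exI[of _ a])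
    qed
  qed
  then obtain a where a: "nul (r - (\<Sum>y\<in>Ps N. [:a y:] *s pp y))" by blast
  \<comment> \<open>Pairing with \<open>pp y\<close> annihilates the null remainder and isolates one
    coefficient.\<close>
  have "a y = ip (pp y) r" if "y \<in> Ps N" for y
  proof -
    have "0 = ip (pp y) r - (\<Sum>z\<in>Ps N. a z * ip (pp y) (pp z))"
      using nul_ip_right[OF a, of "pp y"] by (simp add: ip_diff_right ip_sum_right ip_smult_right)
    also have "(\<Sum>z\<in>Ps N. a z * ip (pp y) (pp z)) = (\<Sum>z\<in>Ps N. if z = y then a z else 0)"
      using that by (intro sum.cong) (auto simp: Ps_def ip_pp)
    also have "\<dots> = a y" using that by simp
    finally show ?thesis by simp
  qed
  then show ?thesis using a by (simp cong: sum.cong)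
qed

lemma ip_pp_low:
  assumes "isP x" "hlt r x"
  shows "ip (pp x) r = 0"
proof -
  let ?s = "\<Sum>y\<in>Ps x. [:ip (pp y) r:] *s pp y"
  have "ip (pp x) ?s = 0"
    using assms(1) by (auto simp: ip_sum_right ip_smult_right Ps_def ip_pp intro!: sum.neutral)
  then show ?thesis
    using nul_ip_right[OF span[OF assms(2)], of "pp x"] by (simp add: ip_diff_right)
qed

text \<open>After subtraction of a multiple of \<open>ph x\<close> the remainder has lower height
  and is orthogonal to \<open>pp x\<close>. This computes the outermost entries of the
  matrix.\<close>

lemma ip_pp_lead:
  assumes "isP x" "hlt r (Suc x)"
  shows "ip (pp x) r = cf r x * of_real (nrm x)"
proof -
  have "hlt (r - [:cf r x:] *s ph x) x"
    using assms(2) by (auto simp: hlt_def cf_ph Suc_le_eq)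
  then have "ip (pp x) (r - [:cf r x:] *s ph x) = 0" by (rule ip_pp_low[OF assms(1)])
  moreover have "ip (pp x) (ph x) = of_real (nrm x)"
    using nrm_pos[OF assms(1)] by (simp add: pp_def ip_smult_left ip_ph_self power2_eq_square)
  ultimately show ?thesis by (simp add: ip_diff_right ip_smult_right)
qed

text \<open>If there were finitely many, then for each \<open>i\<close> the conditions of
  orthogonality to all of them would admit a nonzero polynomial multiple of \<open>axis i 1\<close>,
  which is null by \<open>span\<close>. The product of these polynomials over all \<open>i\<close>
  would contradict \<open>poly_eq_0_if_nul\<close>.\<close>

lemma infinite_isP: "infinite {x. isP x}"
proof
  assume fin: "finite {x. isP x}"
  have "\<exists>p. p \<noteq> 0 \<and> nul (p *s axis i 1)" for i :: 'n
  proof -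
    let ?\<phi> = "\<lambda>x p. ip (pp x) (p *s axis i 1)"
    have smult: "smult c p *s v = [:c:] *s (p *s v)" for c p and v :: "'n vpoly"
      by (simp add: vec_eq_iff)
    obtain p where p: "p \<noteq> 0" "\<forall>x\<in>{x. isP x}. ?\<phi> x p = 0"
      using common_kernel_poly[OF fin, of ?\<phi> 0]
      by (auto simp: ip_add_right vector_sadd_rdistrib smult ip_smult_right simp del: vector_smult_assoc)
    obtain N where "hlt (p *s axis i 1 :: 'n vpoly) N" using hlt_exists by blast
    from span[OF this] p(2) have "nul (p *s axis i 1)" by (simp add: Ps_def)
    with p(1) show ?thesis by blast
  qed
  then obtain P :: "'n \<Rightarrow> complex poly" where P: "\<And>i. P i \<noteq> 0" "\<And>i. nul (P i *s axis i 1)" by metis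
  have "nul ((\<Prod>j\<in>UNIV. P j) *s axis i 1)" for i
  proof -
    have "(\<Prod>j\<in>UNIV. P j) *s axis i 1 = (\<Prod>j\<in>UNIV - {i}. P j) *s (P i *s axis i 1)"
      by (subst prod.remove[of _ i]) (simp_all add: mult.commute)
    then show ?thesis using nul_poly_smult[OF P(2)] by simp
  qed
  then have "(\<Prod>j\<in>UNIV. P j) = 0" by (rule poly_eq_0_if_nul)
  then show False using P(1) by simp
qed

text \<open>A null polynomial of height below n is a constant vector, hence in the kernel of the
  invertible zeroth moment, although its leading coefficient is 1.\<close>

lemma isQ_ge_card:
  assumes "isQ x"
  shows "CARD('n) \<le> x"
proof (rule ccontr)
  assume "\<not> ?thesis"
  then have x: "x < CARD('n)" by simp
  have ph: "ph x = (\<Sum>j\<in>UNIV. [:cf (ph x) (pos j):] *s axis j 1)" (is "_ = ?S")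
  proof (rule vpoly_eqI)
    fix y
    have ax: "cf (axis j 1 :: 'n vpoly) y = of_bool (y = pos j)" for j
    proof -
      have "axis j 1 = (unit_vp (Suc (pos j)) :: 'n vpoly)"
        using pos_less_card[of j] injD[OF inj_pos, of j] by (auto simp: vec_eq_iff axis_def unit_vp_def)
      then show ?thesis by (simp add: cf_unit_vp)
    qed
    show "cf (ph x) y = cf ?S y"
    proof (cases "y < CARD('n)")
      case True
      then obtain i :: 'n where i: "y = pos i" using range_pos by (metis imageE lessThan_iff)
      have "(\<Sum>j::'n\<in>UNIV. cf (ph x) (pos j) * of_bool (pos i = pos j)) = cf (ph x) (pos i)"
        by (simp add: inj_eq[OF inj_pos] of_bool_def if_distrib[of "\<lambda>z. _ * z"] cong: if_cong)
      then show ?thesis by (simp add: cf_sum ax[unfolded i] i)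
    next
      case False
      then have "y \<noteq> pos j" for j :: 'n using pos_less_card by (metis)
      then show ?thesis using False x by (simp add: cf_sum ax cf_ph)
    qed
  qed
  \<comment> \<open>The moment matrix is real, so it annihilates the real part of the constant
    vector as well.\<close>
  define v where "v = (\<chi> j::'n. Re (cf (ph x) (pos j)))"
  have "moment \<sigma> 0 *v v = 0"
  proof (simp add: vec_eq_iff, intro allI)
    fix i
    have "0 = Re (ip (axis i 1) (ph x))" using assms by (simp add: isQ_def nul_ip_right)
    also have "ip (axis i 1) (ph x) = (\<Sum>j\<in>UNIV. cf (ph x) (pos j) * of_real (moment \<sigma> 0 $ i $ j))"
      by (subst ph) (simp add: ip_sum_right ip_smult_right ip_axis)
    also have "Re \<dots> = (moment \<sigma> 0 *v v) $ i"
      by (simp add: matrix_vector_mult_def v_def mult.commute)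
    finally show "(moment \<sigma> 0 *v v) $ i = 0" by simp
  qed
  then have "v = 0"
    using sigma by (simp add: sigma_class_def) (metis invertible_left_inverse matrix_left_invertible_ker)
  moreover obtain i :: 'n where "x = pos i" using x range_pos by (metis imageE lessThan_iff)
  then have "v $ i = 1" by (simp add: v_def cf_ph)
  ultimately show False by simp
qed

end

section \<open>Counting heights and the band structure\<close>

text \<open>Removing the minimum lowers the rank of every other element by one, as in the recursion
  of \<open>enumerate\<close>. It serves both the infinite set of orthonormal heights and the finite
  set of null heights.\<close>

lemma enumerate_card_less:
  fixes N :: nat
  assumes "N \<in> S"
  shows "enumerate S (card {x \<in> S. x < N}) = N"
  using assms
proof (induction "card {x \<in> S. x < N}" arbitrary: S)
  case 0
  then have "{x \<in> S. x < N} = {}" by (metis (no_types, lifting) card_0_eq finite_nat_set_iff_bounded mem_Collect_eq)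
  then have "(LEAST n. n \<in> S) = N" using 0 by (intro Least_equality) (auto simp: not_less)
  then show ?case unfolding 0(1)[symmetric] enumerate_0 .
next
  case (Suc c)
  let ?m = "LEAST n. n \<in> S"
  have "{x \<in> S. x < N} \<noteq> {}" using Suc(2) by (metis card.empty nat.distinct(1))
  then obtain y where y: "y \<in> S" "y < N" by auto
  have m: "?m \<in> S" "?m < N"
    using LeastI[of "\<lambda>n. n \<in> S", OF y(1)] Least_le[of "\<lambda>n. n \<in> S", OF y(1)] y(2) by auto
  have eq: "{x \<in> S. x < N} = insert ?m {x \<in> S - {?m}. x < N}" using m by auto
  have "c = card {x \<in> S - {?m}. x < N}"
    using Suc(2) unfolding eq by simp
  then show ?case
    using Suc(1)[of "S - {?m}"] Suc(2,3) m by (metis Diff_iff enumerate_Suc less_irrefl singletonD)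
qed

lemma filter_upt_conv_enumerate:
  "filter (\<lambda>x. x \<in> S) [0..<N] = map (enumerate S) [0..<card {x \<in> S. x < N}]"
proof (induction N)
  case (Suc N)
  show ?case
  proof (cases "N \<in> S")
    case True
    then have "{x \<in> S. x < Suc N} = insert N {x \<in> S. x < N}" by auto
    then show ?thesis using Suc True by (simp add: enumerate_card_less)
  next
    case False
    then have "{x \<in> S. x < Suc N} = {x \<in> S. x < N}" by (auto simp: less_Suc_eq)
    then show ?thesis using Suc False by simp
  qed
qed simp

lemma card_less_enumerate:
  fixes S :: "nat set"
  assumes "infinite S \<or> i < card S"
  shows "card {x \<in> S. x < enumerate S i} = i"
proof -
  have mono: "enumerate S k < enumerate S l \<longleftrightarrow> k < l"
    if "infinite S \<or> k < card S" "infinite S \<or> l < card S" for k l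
    using that by (cases "finite S") (auto simp: enumerate_mono_iff finite_enumerate_mono_iff)
  have mem: "enumerate S k \<in> S" if "infinite S \<or> k < card S" for k
    using that by (cases "finite S") (auto simp: enumerate_in_set finite_enumerate_in_set)
  have le: "infinite S \<or> k < card S" if "k < i" for k using that assms by auto
  have "{x \<in> S. x < enumerate S i} = enumerate S ` {..<i}"
  proof safe
    fix x assume x: "x \<in> S" "x < enumerate S i"
    let ?k = "card {y \<in> S. y < x}"
    have "infinite S \<or> ?k < card S"
      using x(1) by (auto intro!: psubset_card_mono)
    then have "?k < i" using x mono[of ?k i] assms enumerate_card_less[OF x(1)] by simp
    then show "x \<in> enumerate S ` {..<i}"
      using enumerate_card_less[OF x(1)] by (intro image_eqI[of _ _ ?k]) simp_all
  qed (use mono le assms mem in auto)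
  moreover have "inj_on (enumerate S) {..<i}"
    using mono[OF le le] by (intro inj_onI) (metis lessThan_iff less_irrefl linorder_neqE_nat)
  ultimately show ?thesis by (simp add: card_image)
qed

text \<open>Turns the diagonal notation of the recurrence into a plain sum over column
  \<open>k\<close>.\<close>

lemma band_sum:
  fixes p :: "nat \<Rightarrow> complex poly ^ 'n"
  assumes sym: "\<And>i k. i \<ge> 1 \<Longrightarrow> k \<ge> 1 \<Longrightarrow> A i k = A k i"
    and band: "\<And>i k. i \<ge> 1 \<Longrightarrow> k \<ge> 1 \<Longrightarrow> i > k + n \<Longrightarrow> A i k = 0"
    and p0: "p 0 = 0" and k: "k \<ge> 1"
  shows "(\<Sum>i<n. [:complex_of_real (diag_entry A (n - i) (k + i - n)):] *s p (k + i - n))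
      + [:complex_of_real (diag_entry A 0 k):] *s p k
      + (\<Sum>i=1..n. [:complex_of_real (diag_entry A i k):] *s p (k + i))
    = (\<Sum>i=1..k + n. [:complex_of_real (A i k):] *s p i)"
proof -
  let ?f = "\<lambda>i. [:complex_of_real (A i k):] *s p i"
  have "[:complex_of_real (diag_entry A (n - i) (k + i - n)):] *s p (k + i - n) = ?f (k + i - n)"
    if "i < n" for i
    using that p0 by (cases "n \<le> k + i") (auto simp: diag_entry_def)
  then have "(\<Sum>i<n. [:complex_of_real (diag_entry A (n - i) (k + i - n)):] *s p (k + i - n)) =
      (\<Sum>i<n. ?f (k + i - n))"
    by (intro sum.cong) auto
  also have "\<dots> = sum ?f {1..<k}"
  \<comment> \<open>\<open>S'\<close> holds the indices that truncated subtraction sends to 0, where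
    \<open>p\<close> vanishes; \<open>T'\<close> holds the rows above the band, where the matrix
    entry vanishes.\<close>
  proof (rule sum.reindex_bij_witness_not_neutral[where S' = "{i. i < n \<and> k + i \<le> n}"
        and T' = "{t. 1 \<le> t \<and> t + n < k}" and i = "\<lambda>t. t + n - k" and j = "\<lambda>i. k + i - n"])
    show "finite {t. 1 \<le> t \<and> t + n < k}" by (rule finite_subset[of _ "{..k}"]) auto
    show "finite {i. i < n \<and> k + i \<le> n}" by simp
    fix t assume "t \<in> {t. 1 \<le> t \<and> t + n < k}"
    then have "A t k = 0" using sym[of t k] band[of k t] k by auto
    then show "[:complex_of_real (A t k):] *s p t = 0" by simp
  qed (use p0 k in auto)
  finally have "(\<Sum>i<n. [:complex_of_real (diag_entry A (n - i) (k + i - n)):] *s p (k + i - n)) =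
      sum ?f {1..<k}" .
  moreover have "(\<Sum>i=1..n. [:complex_of_real (diag_entry A i k):] *s p (k + i)) = sum ?f {k + 1..k + n}"
    using sym k by (intro sum.reindex_bij_witness[of _ "\<lambda>i. i - k" "\<lambda>i. k + i"]) (auto simp: diag_entry_def)
  moreover have "{1..k + n} = insert k ({1..<k} \<union> {k + 1..k + n})" using k by auto
  then have "sum ?f {1..k + n} = ?f k + (sum ?f {1..<k} + sum ?f {k + 1..k + n})"
    by (subst sum.union_disjoint[symmetric]) auto
  ultimately show ?thesis by (simp only:) (simp add: diag_entry_def)
qed

text \<open>By induction on \<open>j\<close>: at \<open>m (Suc j)\<close> the diagonal
  \<open>n - j\<close> is already zero, so the other sequence must have reached its next index by
  then, and conversely.\<close>

lemma degeneration_indices_unique: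
  assumes A: "degeneration_indices n A j0 m" and A': "degeneration_indices n A j0' m'"
  shows "j0 = j0' \<and> (\<forall>j\<le>j0. m j = m' j)"
proof -
  have pos: "diag_entry A (n - j) k > 0"
    if "degeneration_indices n A j0 m" "j \<le> j0" "m j < k" "j < j0 \<Longrightarrow> k < m (Suc j)" for j0 m j k
    using that by (auto simp: degeneration_indices_def)
  have zero: "diag_entry A (n - j) k = 0"
    if "degeneration_indices n A j0 m" "j < j0" "m (Suc j) \<le> k" for j0 m j k
    using that by (auto simp: degeneration_indices_def)
  have step: "m j < m (Suc j)" if "degeneration_indices n A j0 m" "j < j0" for j0 m j
    using that by (auto simp: degeneration_indices_def)
  have le: "j < j0' \<and> m' (Suc j) \<le> m (Suc j)"
    if B: "degeneration_indices n A j0 m" "degeneration_indices n A j0' m'"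
      and j: "j < j0" "j \<le> j0'" "m j = m' j" for j0 m j0' m' j
    using zero[OF B(1) j(1), of "m (Suc j)"] pos[OF B(2) j(2), of "m (Suc j)"] step[OF B(1) j(1)] j
    by force
  have eq: "j \<le> j0 \<Longrightarrow> j \<le> j0' \<Longrightarrow> m j = m' j" for j
  proof (induction j)
    case 0
    then show ?case using A A' by (simp add: degeneration_indices_def)
  next
    case (Suc j)
    then show ?case using le[OF A A', of j] le[OF A' A, of j] by simp
  qed
  moreover have "j0 = j0'"
    using le[OF A A', of j0'] le[OF A' A, of j0] eq by (metis less_irrefl linorder_neqE_nat order.strict_implies_order order_refl)
  ultimately show ?thesis by simp
qed

declare gs.simps(2) [simp del]

section \<open>Counting orthonormal and null heights\<close>

context sigma_matfun
begin

text \<open>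
  \<open>hgt k\<close> and \<open>hq j\<close> are the heights of the k-th orthonormal and of the j-th null polynomial,
  counted from 1; \<open>cP N\<close> and \<open>cQ N\<close> are the numbers of such heights below N.
\<close>

definition Qs :: "nat set" where
  "Qs = {x. isQ x}"

definition cP :: "nat \<Rightarrow> nat" where
  "cP N = card (Ps N)"

definition cQ :: "nat \<Rightarrow> nat" where
  "cQ N = card {x \<in> Qs. x < N}"

definition hgt :: "nat \<Rightarrow> nat" where
  "hgt k = enumerate {x. isP x} (k - 1)"

definition hq :: "nat \<Rightarrow> nat" where
  "hq j = enumerate Qs (j - 1)"

lemma Ps_alt: "Ps N = {x \<in> {x. isP x}. x < N}"
  by (auto simp: Ps_def)

lemma isP_hgt: "isP (hgt k)"
  using enumerate_in_set[OF infinite_isP] by (auto simp: hgt_def)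

lemma cP_hgt: "cP (hgt k) = k - 1"
  unfolding cP_def Ps_alt hgt_def by (rule card_less_enumerate) (simp add: infinite_isP)

lemma hgt_cP: "isP x \<Longrightarrow> hgt (Suc (cP x)) = x"
  using enumerate_card_less[of x "{x. isP x}"] by (simp add: hgt_def cP_def Ps_alt)

lemma cP_Suc: "cP (Suc N) = cP N + of_bool (isP N)"
proof -
  have "Ps (Suc N) = (if isP N then insert N (Ps N) else Ps N)"
    by (auto simp: Ps_def less_Suc_eq)
  then show ?thesis by (auto simp: cP_def Ps_def)
qed

lemma cP_mono: "M \<le> N \<Longrightarrow> cP M \<le> cP N"
  unfolding cP_def by (intro card_mono) (auto simp: Ps_def)

text \<open>A Galois connection between the enumeration and the counting function; it carries the
  index computations below.\<close>

lemma hgt_less_iff: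
  assumes "k \<ge> 1"
  shows "hgt k < N \<longleftrightarrow> k \<le> cP N"
proof (cases "hgt k < N")
  case True
  then show ?thesis
    using cP_mono[of "Suc (hgt k)" N] cP_Suc[of "hgt k"] cP_hgt[of k] isP_hgt[of k] by simp
next
  case False
  then show ?thesis using cP_mono[of N "hgt k"] cP_hgt[of k] assms by simp
qed

lemma hgt_inj: "k \<ge> 1 \<Longrightarrow> l \<ge> 1 \<Longrightarrow> hgt k = hgt l \<longleftrightarrow> k = l"
  using cP_hgt[of k] cP_hgt[of l] by auto

lemma hgt_less: "k \<ge> 1 \<Longrightarrow> l \<ge> 1 \<Longrightarrow> hgt k < hgt l \<longleftrightarrow> k < l"
  using hgt_less_iff[of k "hgt l"] cP_hgt[of l] by auto

text \<open>The lists of successive steps are prefixes of one sequence, so the entry can be read at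
  any step that is late enough.\<close>

lemma gs_p_eq:
  assumes "k \<ge> 1"
  shows "gs_p \<sigma> k = pp (hgt k)"
proof -
  have fst: "fst (gs \<sigma> N) = map pp (map (enumerate {x. isP x}) [0..<cP N])" for N
    using filter_upt_conv_enumerate[of "{x. isP x}" N] by (simp add: gs_eq cP_def Ps_alt)
  define N where "N = (LEAST N. k \<le> length (fst (gs \<sigma> N)))"
  have "k \<le> length (fst (gs \<sigma> (Suc (hgt k))))"
    using cP_Suc[of "hgt k"] cP_hgt[of k] isP_hgt[of k] by (simp add: fst)
  then have "k \<le> length (fst (gs \<sigma> N))" unfolding N_def by (rule LeastI)
  then have "fst (gs \<sigma> N) ! (k - 1) = pp (hgt k)"
    using assms by (simp add: fst hgt_def)
  then show ?thesis by (simp add: gs_p_def N_def)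
qed

text \<open>Null heights are pairwise incongruent modulo n. If they met every residue class, all
  heights beyond the largest would be skipped, against \<open>infinite_isP\<close>.\<close>

lemma finite_Qs: "finite Qs" and card_Qs: "card Qs \<le> CARD('n) - 1"
proof -
  let ?r = "\<lambda>x. x mod CARD('n)"
  have inj: "inj_on ?r Qs"
    by (rule inj_onI) (auto simp: Qs_def intro: isQ_mod_inj)
  have sub: "?r ` Qs \<subseteq> {..<CARD('n)}" by auto
  show fin: "finite Qs" using inj_on_finite[OF inj sub] by simp
  have "?r ` Qs \<noteq> {..<CARD('n)}"
  proof
    assume eq: "?r ` Qs = {..<CARD('n)}"
    have "{x. isP x} \<subseteq> {..Max Qs}"
    proof
      fix x assume "x \<in> {x. isP x}"
      then have x: "isP x" by simp
      obtain y where y: "y \<in> Qs" "x mod CARD('n) = y mod CARD('n)"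
      proof -
        have "x mod CARD('n) \<in> ?r ` Qs" unfolding eq by simp
        then show ?thesis using that by auto
      qed
      have "x < y"
      proof (rule ccontr)
        assume "\<not> x < y"
        then have "CARD('n) dvd x - y" using y(2) by (simp add: mod_eq_dvd_iff_nat)
        then obtain l where "x = y + CARD('n) * l"
          using \<open>\<not> x < y\<close> by (metis dvdE le_add_diff_inverse not_less)
        then show False using x y(1) unfolding isP_iff Qs_def by blast
      qed
      also have "y \<le> Max Qs" using fin y(1) by simp
      finally show "x \<in> {..Max Qs}" by simp
    qed
    then show False using infinite_isP finite_subset by blast
  qed
  then have "?r ` Qs \<subset> {..<CARD('n)}" using sub by blast
  then have "card (?r ` Qs) < CARD('n)" using psubset_card_mono[of "{..<CARD('n)}"] by simp
  then show "card Qs \<le> CARD('n) - 1" using card_image[OF inj] by simp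
qed

lemma isQ_hq: "j \<in> {1..card Qs} \<Longrightarrow> isQ (hq j)"
  using finite_enumerate_in_set[OF finite_Qs, of "j - 1"] by (auto simp: hq_def Qs_def)

lemma cQ_hq: "j \<in> {1..card Qs} \<Longrightarrow> cQ (hq j) = j - 1"
  unfolding cQ_def hq_def by (rule card_less_enumerate) auto

lemma isQ_E:
  assumes "isQ x"
  obtains j where "j \<in> {1..card Qs}" "x = hq j"
proof
  show "x = hq (Suc (cQ x))"
    using enumerate_card_less[of x Qs] assms by (simp add: hq_def cQ_def Qs_def)
  have "cQ x < card Qs"
    unfolding cQ_def using assms finite_Qs by (intro psubset_card_mono) (auto simp: Qs_def)
  then show "Suc (cQ x) \<in> {1..card Qs}" by simp
qed

lemma cQ_Suc: "cQ (Suc N) = cQ N + of_bool (isQ N)"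
proof -
  have "{x \<in> Qs. x < Suc N} = (if isQ N then insert N {x \<in> Qs. x < N} else {x \<in> Qs. x < N})"
    by (auto simp: Qs_def less_Suc_eq)
  then show ?thesis by (auto simp: cQ_def)
qed

lemma cQ_mono: "M \<le> N \<Longrightarrow> cQ M \<le> cQ N"
  unfolding cQ_def using finite_Qs by (intro card_mono) auto

lemma cQ_le: "cQ N \<le> card Qs"
  unfolding cQ_def using finite_Qs by (intro card_mono) auto

lemma hq_less_iff:
  assumes "j \<in> {1..card Qs}"
  shows "hq j < N \<longleftrightarrow> j \<le> cQ N"
proof (cases "hq j < N")
  case True
  then show ?thesis
    using cQ_mono[of "Suc (hq j)" N] cQ_Suc[of "hq j"] cQ_hq[OF assms] isQ_hq[OF assms] by simp
next
  case False
  then have "cQ N \<le> j - 1" using cQ_mono[of N "hq j"] cQ_hq[OF assms] by simp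
  moreover have "1 \<le> j" using assms by simp
  ultimately show ?thesis using False by linarith
qed

lemma snd_gs: "snd (gs \<sigma> N) = map ph (map (enumerate Qs) [0..<cQ N])"
  using filter_upt_conv_enumerate[of Qs N] by (simp add: gs_eq cQ_def Qs_def)

lemma gs_j0_eq: "gs_j0 \<sigma> = card Qs"
  unfolding gs_j0_def
proof (rule Least_equality)
  show "\<forall>N. length (snd (gs \<sigma> N)) \<le> card Qs" by (simp add: snd_gs cQ_le)
  fix j assume j: "\<forall>N. length (snd (gs \<sigma> N)) \<le> j"
  obtain N where "\<forall>x\<in>Qs. x < N" using finite_Qs finite_nat_set_iff_bounded by auto
  then have "cQ N = card Qs" unfolding cQ_def by (intro arg_cong[of _ _ card]) auto
  then show "card Qs \<le> j" using spec[OF j, of N] by (simp add: snd_gs)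
qed

lemma Least_gs_q: "j \<in> {1..card Qs} \<Longrightarrow> (LEAST N. j \<le> length (snd (gs \<sigma> N))) = Suc (hq j)"
  using hq_less_iff[of j] by (intro Least_equality) (auto simp: snd_gs Suc_le_eq)

lemma nul_gs_q:
  assumes "j \<in> {1..gs_j0 \<sigma>}"
  shows "nul (gs_q \<sigma> j)"
proof -
  have j: "j \<in> {1..card Qs}" using assms by (simp add: gs_j0_eq)
  have "j \<le> cQ (Suc (hq j))" using hq_less_iff[OF j, of "Suc (hq j)"] by simp
  moreover obtain i where "j = Suc i" using j by (cases j) auto
  ultimately have "gs_q \<sigma> j = ph (hq j)"
    unfolding gs_q_def Least_gs_q[OF j] by (simp add: snd_gs hq_def)
  then show ?thesis using isQ_hq[OF j] by (simp add: isQ_def)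
qed

text \<open>The null polynomial appears at step \<open>Suc (hq j)\<close>, and that step adds no
  orthonormal one.\<close>

lemma gs_count_eq:
  assumes "j \<in> {1..card Qs}"
  shows "gs_count \<sigma> j = cP (hq j)"
proof -
  have "length (fst (gs \<sigma> N)) = cP N" for N
    using filter_upt_conv_enumerate[of "{x. isP x}" N] by (simp add: gs_eq cP_def Ps_alt)
  moreover have "\<not> isP (hq j)" using isQ_hq[OF assms] by (simp add: isQ_def isP_def)
  ultimately show ?thesis unfolding gs_count_def Least_gs_q[OF assms] by (simp add: cP_Suc)
qed

text \<open>A window of length n contains exactly one member \<open>s + n l\<close> of each residue class of a null
  height \<open>s\<close> below its end.\<close>

lemma cP_window: "cP (N + CARD('n)) + cQ (N + CARD('n)) = cP N + CARD('n)"
proof -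
  let ?n = "CARD('n)"
  let ?W = "{x. N \<le> x \<and> x < N + ?n \<and> isP x}" and ?V = "{x. N \<le> x \<and> x < N + ?n \<and> \<not> isP x}"
  have "Ps (N + ?n) = Ps N \<union> ?W" "Ps N \<inter> ?W = {}" by (auto simp: Ps_def)
  then have "cP (N + ?n) = cP N + card ?W" by (simp add: cP_def card_Un_disjoint)
  moreover have "card ?W + card ?V = ?n"
  proof -
    have "card ?W + card ?V = card (?W \<union> ?V)" by (rule card_Un_disjoint[symmetric]) auto
    also have "?W \<union> ?V = {N..<N + ?n}" by auto
    finally show ?thesis by simp
  qed
  moreover have "card ?V = cQ (N + ?n)"
    unfolding cQ_def
  proof (rule bij_betw_same_card[symmetric], rule bij_betw_imageI)
    \<comment> \<open>The largest number below \<open>N + n\<close> congruent to \<open>s\<close>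
      modulo n; being the largest, it lies in the window.\<close>
    let ?f = "\<lambda>s. s + ?n * ((N + ?n - 1 - s) div ?n)"
    let ?S = "{x \<in> Qs. x < N + ?n}"
    show "inj_on ?f ?S"
      by (rule inj_onI, rule isQ_mod_inj) (auto simp: Qs_def, metis mod_mult_self2)
    show "?f ` ?S = ?V"
    proof safe
      fix s assume s: "s \<in> Qs" "s < N + ?n"
      define d where "d = N + ?n - 1 - s"
      have d: "N + ?n = Suc (d + s)" using s by (simp add: d_def)
      have "d = ?n * (d div ?n) + d mod ?n" "d mod ?n < ?n" by simp_all
      then show "N \<le> ?f s" "?f s < N + ?n" unfolding d_def[symmetric] using d by linarith+
      assume "isP (?f s)"
      then show False using s(1) by (auto simp: isP_iff Qs_def)
    next
      fix x assume x: "N \<le> x" "x < N + ?n" "\<not> isP x"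
      then obtain s l where s: "isQ s" "x = s + ?n * l" by (auto simp: isP_iff)
      define e where "e = N + ?n - 1 - x"
      have e: "N + ?n - 1 - s = e + ?n * l" "e < ?n" using x s by (auto simp: e_def)
      have "?f s = x" unfolding e(1) using e(2) s(2) by simp
      then show "x \<in> ?f ` ?S" using s x by (intro image_eqI[of _ _ s]) (auto simp: Qs_def)
    qed
  qed
  ultimately show ?thesis by simp
qed

lemma isP_less_card: "x < CARD('n) \<Longrightarrow> isP x"
  using isQ_ge_card by (force simp: isP_iff)

lemma cP_le_card: "x \<le> CARD('n) \<Longrightarrow> cP x = x"
  by (induction x) (auto simp: cP_Suc isP_less_card, simp add: cP_def Ps_def)

lemma hgt_le_card: "k \<in> {1..CARD('n)} \<Longrightarrow> hgt k = k - 1"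
  using hgt_cP[of "k - 1"] isP_less_card[of "k - 1"] cP_le_card[of "k - 1"] by auto

text \<open>If \<open>x - n\<close> were \<open>s + n l\<close> for a null height \<open>s\<close>,
  then \<open>x\<close> would be skipped.\<close>

lemma isP_diff: "CARD('n) \<le> x \<Longrightarrow> isP x \<or> isQ x \<Longrightarrow> isP (x - CARD('n))"
proof (rule ccontr)
  assume x: "CARD('n) \<le> x" "isP x \<or> isQ x" and "\<not> isP (x - CARD('n))"
  then obtain s l where s: "isQ s" "x - CARD('n) = s + CARD('n) * l" by (auto simp: isP_iff)
  then have "x = s + CARD('n) * Suc l" using x(1) by simp
  then show False using x(2) s(1) isP_iff[of x] isQ_not_skip[of s x "Suc l"] by blast
qed

section \<open>The coefficient matrix and its band structure\<close>

definition A :: "nat \<Rightarrow> nat \<Rightarrow> real" where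
  "A i k = Re (ip (pp (hgt i)) ([:0, 1:] *s pp (hgt k)))"

text \<open>The orthonormal polynomials have real coefficients, so the real part in \<open>A\<close>
  loses nothing.\<close>

lemma of_real_A: "of_real (A i k) = ip (pp (hgt i)) ([:0, 1:] *s pp (hgt k))"
  unfolding A_def by (intro of_real_Re ip_real real_vp_shift real_vp_pp)

lemma A_sym: "A i k = A k i"
proof -
  have "complex_of_real (A i k) = cnj (of_real (A k i))"
    unfolding of_real_A by (simp only: ip_cnj ip_shift)
  then show ?thesis by simp
qed

lemma hlt_shift_pp: "hlt ([:0, 1:] *s pp x) (Suc (x + CARD('n)))"
  using hlt_pp[of x] by (auto simp: hlt_def cf_shift)

text \<open>\<open>U k\<close> is the last row index that can be nonzero in column k.\<close>

definition U :: "nat \<Rightarrow> nat" where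
  "U k = cP (Suc (hgt k + CARD('n)))"

lemma A_eq_0: "i > U k \<Longrightarrow> A i k = 0"
proof -
  assume i: "i > U k"
  then have "\<not> hgt i < Suc (hgt k + CARD('n))" by (subst hgt_less_iff) (auto simp: U_def)
  then have "hlt ([:0, 1:] *s pp (hgt k)) (hgt i)" by (intro hlt_mono[OF hlt_shift_pp]) simp
  then have "complex_of_real (A i k) = 0" unfolding of_real_A by (intro ip_pp_low isP_hgt)
  then show ?thesis by simp
qed

lemma hgt_U: "isP (hgt k + CARD('n)) \<Longrightarrow> hgt (U k) = hgt k + CARD('n)"
  using hgt_cP[of "hgt k + CARD('n)"] by (simp add: U_def cP_Suc)

text \<open>The leading coefficient of z times \<open>pp (hgt k)\<close> is
  \<open>1 / nrm (hgt k)\<close>, so the entry is a quotient of two positive norms.\<close>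

lemma A_U_pos:
  assumes "isP (hgt k + CARD('n))"
  shows "A (U k) k > 0"
proof -
  have "complex_of_real (A (U k) k) =
      cf ([:0, 1:] *s pp (hgt k)) (hgt k + CARD('n)) * of_real (nrm (hgt k + CARD('n)))"
    unfolding of_real_A hgt_U[OF assms] by (intro ip_pp_lead assms hlt_shift_pp)
  also have "\<dots> = of_real (1 / nrm (hgt k) * nrm (hgt k + CARD('n)))"
    by (simp add: cf_shift cf_pp)
  finally have "A (U k) k = 1 / nrm (hgt k) * nrm (hgt k + CARD('n))"
    by (simp only: of_real_eq_iff)
  then show ?thesis using nrm_pos[OF assms] nrm_pos[OF isP_hgt[of k]] by simp
qed

text \<open>The window count for the n heights following \<open>hgt k\<close>. The value of
  \<open>cQ\<close> is the number of diagonals the band has lost by row \<open>k\<close>.\<close>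

lemma U_eq: "k \<ge> 1 \<Longrightarrow> U k + cQ (Suc (hgt k + CARD('n))) = k + CARD('n)"
  using cP_window[of "Suc (hgt k)"] cP_Suc[of "hgt k"] cP_hgt[of k] isP_hgt[of k] by (simp add: U_def)

lemma expansion:
  "nul ([:0, 1:] *s pp (hgt k) - (\<Sum>i=1..U k. [:of_real (A i k):] *s pp (hgt i)))"
proof -
  have "(\<Sum>y\<in>Ps (Suc (hgt k + CARD('n))). [:ip (pp y) ([:0, 1:] *s pp (hgt k)):] *s pp y) =
    (\<Sum>i=1..U k. [:of_real (A i k):] *s pp (hgt i))"
  proof (rule sum.reindex_bij_witness[of _ hgt "\<lambda>x. Suc (cP x)"])
    fix x assume "x \<in> Ps (Suc (hgt k + CARD('n)))"
    then have x: "isP x" "x < Suc (hgt k + CARD('n))" by (auto simp: Ps_def)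
    show "hgt (Suc (cP x)) = x" using x(1) by (rule hgt_cP)
    then show "Suc (cP x) \<in> {1..U k}"
      using hgt_less_iff[of "Suc (cP x)" "Suc (hgt k + CARD('n))"] x(2) by (simp add: U_def)
    show "[:of_real (A (Suc (cP x)) k):] *s pp (hgt (Suc (cP x))) =
        [:ip (pp x) ([:0, 1:] *s pp (hgt k)):] *s pp x"
      by (simp only: of_real_A hgt_cP[OF x(1)])
  next
    fix i assume i: "i \<in> {1..U k}"
    then show "Suc (cP (hgt i)) = i" by (simp add: cP_hgt)
    show "hgt i \<in> Ps (Suc (hgt k + CARD('n)))"
      using i hgt_less_iff[of i "Suc (hgt k + CARD('n))"] by (simp add: Ps_def isP_hgt U_def)
  qed
  then show ?thesis using span[OF hlt_shift_pp[of "hgt k"]] by simp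
qed

definition m :: "nat \<Rightarrow> nat" where
  "m j = (if j = 0 then 0 else Suc (cP (hq j - CARD('n))))"

lemma hgt_m: "j \<in> {1..card Qs} \<Longrightarrow> hgt (m j) + CARD('n) = hq j"
  using isQ_ge_card[OF isQ_hq[of j]] hgt_cP[OF isP_diff[of "hq j"]] isQ_hq[of j] by (simp add: m_def)

lemma m_ge_1: "j \<ge> 1 \<Longrightarrow> m j \<ge> 1"
  by (simp add: m_def)

lemma m_le_iff: "j \<in> {1..card Qs} \<Longrightarrow> k \<ge> 1 \<Longrightarrow> m j \<le> k \<longleftrightarrow> j \<le> cQ (Suc (hgt k + CARD('n)))"
  using hq_less_iff[of j "Suc (hgt k + CARD('n))"] hgt_m[of j] hgt_less[of k "m j"] m_ge_1[of j]
  by auto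

lemma m_less_iff: "i \<in> {1..card Qs} \<Longrightarrow> j \<in> {1..card Qs} \<Longrightarrow> m i < m j \<longleftrightarrow> i < j"
  using hgt_m[of i] hgt_m[of j] hgt_less[of "m i" "m j"] m_ge_1[of i] m_ge_1[of j] hq_less_iff[of i "hq j"] cQ_hq[of j]
  by auto

text \<open>The height \<open>hgt k + n\<close> cannot be skipped, since \<open>hgt k\<close> would
  then lie in the same progression of excluded heights. So it is null or orthonormal, and it is null
  exactly at the indices \<open>m j\<close>.\<close>

lemma isP_iff_m:
  assumes "k \<ge> 1"
  shows "isP (hgt k + CARD('n)) \<longleftrightarrow> k \<notin> m ` {1..card Qs}"
proof
  assume P: "isP (hgt k + CARD('n))"
  show "k \<notin> m ` {1..card Qs}"
  proof
    assume "k \<in> m ` {1..card Qs}"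
    then obtain j where "j \<in> {1..card Qs}" "k = m j" by blast
    then show False using P hgt_m[of j] isQ_hq[of j] by (auto simp: isP_def isQ_def)
  qed
next
  assume k: "k \<notin> m ` {1..card Qs}"
  show "isP (hgt k + CARD('n))"
  proof (rule ccontr)
    assume "\<not> isP (hgt k + CARD('n))"
    then obtain s l where s: "isQ s" "hgt k + CARD('n) = s + CARD('n) * l" by (auto simp: isP_iff)
    have "l = 0"
    proof (rule ccontr)
      assume "l \<noteq> 0"
      then obtain l' where "l = Suc l'" using not0_implies_Suc by blast
      then have "hgt k = s + CARD('n) * l'" using s(2) by simp
      then show False using isP_hgt[of k] s(1) by (auto simp: isP_iff)
    qed
    obtain j where j: "j \<in> {1..card Qs}" "s = hq j" using isQ_E[OF s(1)] .
    then have "hgt (m j) = hgt k" using hgt_m[OF j(1)] s(2) \<open>l = 0\<close> by simp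
    then have "k = m j" using hgt_inj[of "m j" k] assms m_ge_1[of j] j(1) by auto
    then show False using k j(1) by blast
  qed
qed

lemma cQ_between:
  assumes "j \<le> card Qs" "k \<ge> 1" "m j \<le> k" "j < card Qs \<Longrightarrow> k < m (Suc j)"
  shows "cQ (Suc (hgt k + CARD('n))) = j"
proof (rule antisym)
  show "j \<le> cQ (Suc (hgt k + CARD('n)))"
    using m_le_iff[of j k] assms by (cases "j = 0") auto
  show "cQ (Suc (hgt k + CARD('n))) \<le> j"
    using m_le_iff[of "Suc j" k] assms cQ_le[of "Suc (hgt k + CARD('n))"]
    by (cases "j < card Qs") auto
qed

text \<open>Strictly between \<open>m j\<close> and \<open>m (Suc j)\<close> the last row index
  \<open>U k\<close> equals \<open>k + (n - j)\<close>, and \<open>A_U_pos\<close> gives a positive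
  entry there. From \<open>m (Suc j)\<close> on, \<open>U k\<close> is smaller, so diagonal
  \<open>n - j\<close> vanishes.\<close>

lemma degeneration_indices_A: "degeneration_indices CARD('n) A (card Qs) m"
  unfolding degeneration_indices_def
proof (intro conjI allI impI)
  fix k l :: nat assume kl: "1 \<le> k" "1 \<le> l" "k + CARD('n) < l \<or> l + CARD('n) < k"
  then show "A k l = 0"
    using A_eq_0[of k l] A_eq_0[of l k] A_sym[of k l] U_eq[of k] U_eq[of l] by auto
next
  fix j assume "j < card Qs"
  then show "m j < m (Suc j)" using m_less_iff[of j "Suc j"] m_ge_1[of "Suc j"]
    by (cases "j = 0") (auto simp: m_def)
next
  fix j k assume j: "j \<le> card Qs" and k: "m j < k \<and> (j < card Qs \<longrightarrow> k < m (Suc j))"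
  have cQ: "cQ (Suc (hgt k + CARD('n))) = j" using j k by (intro cQ_between) auto
  have "k \<notin> m ` {1..card Qs}"
  proof
    assume "k \<in> m ` {1..card Qs}"
    then obtain i where i: "i \<in> {1..card Qs}" "k = m i" by blast
    then have "i \<le> j" using m_le_iff[of i k] k cQ by auto
    then show False using m_less_iff[of j i] i k j by auto
  qed
  then have "A (U k) k > 0" using A_U_pos isP_iff_m[of k] k by auto
  moreover have "U k = k + (CARD('n) - j)" using U_eq[of k] cQ k j card_Qs by auto
  ultimately show "0 < diag_entry A (CARD('n) - j) k"
    by (simp add: diag_entry_def A_sym[of k])
next
  fix j k assume j: "j < card Qs" "m (Suc j) \<le> k"
  then have k: "k \<ge> 1" using m_ge_1[of "Suc j"] by simp
  then have "Suc j \<le> cQ (Suc (hgt k + CARD('n)))" using m_le_iff[of "Suc j" k] j by auto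
  then have "U k < k + (CARD('n) - j)" using U_eq[OF k] j card_Qs by simp
  then show "diag_entry A (CARD('n) - j) k = 0"
    using A_eq_0 by (simp add: diag_entry_def A_sym[of k])
qed (use card_Qs A_sym in \<open>auto simp: m_def\<close>)

text \<open>The window ending just below \<open>hq j\<close>: it starts at \<open>hq j - n\<close>,
  with \<open>m j - 1\<close> orthonormal heights before it, and \<open>j - 1\<close> null heights
  precede its end.\<close>

lemma gs_count_m:
  assumes "j \<in> {1..card Qs}"
  shows "gs_count \<sigma> j + j = m j + CARD('n)"
proof -
  obtain i where "j = Suc i" using assms by (cases j) auto
  then show ?thesis
    using cP_window[of "hq j - CARD('n)"] gs_count_eq[OF assms] cQ_hq[OF assms]
      isQ_ge_card[OF isQ_hq[OF assms]]
    by (simp add: m_def)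
qed

lemma separated_iff: "separated_indices (card Qs) m \<longleftrightarrow> gs_separated \<sigma>"
proof
  assume sep: "separated_indices (card Qs) m"
  \<comment> \<open>\<open>gs_separated\<close> bounds the count at every \<open>j\<close> below by
    n, which needs \<open>m j > j\<close>; this growth provides it.\<close>
  have "2 * j \<le> m j" if "j \<le> card Qs" for j
    using that
  proof (induction j)
    case (Suc j)
    then have "m j + 1 < m (Suc j)" using sep unfolding separated_indices_def by simp
    then show ?case using Suc by simp
  qed simp
  note m_ge = this
  show "gs_separated \<sigma>"
    unfolding gs_separated_def gs_j0_eq
  proof (intro conjI ballI)
    fix j assume j: "j \<in> {1..card Qs}"
    then show "CARD('n) < gs_count \<sigma> j"
      using gs_count_m[OF j] m_ge[of j] by simp
  next
    fix j assume j: "j \<in> {1..<card Qs}"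
    then have "m j + 1 < m (Suc j)" using sep by (simp add: separated_indices_def)
    then show "gs_count \<sigma> j < gs_count \<sigma> (Suc j)"
      using gs_count_m[of j] gs_count_m[of "Suc j"] j by simp
  qed
next
  assume sep: "gs_separated \<sigma>"
  show "separated_indices (card Qs) m"
    unfolding separated_indices_def
  proof (intro allI impI)
    fix j assume j: "j < card Qs"
    show "m j + 1 < m (Suc j)"
    proof (cases "j = 0")
      case True
      then have "CARD('n) < gs_count \<sigma> 1" using sep j by (auto simp: gs_separated_def gs_j0_eq)
      then show ?thesis using gs_count_m[of 1] j True by (simp add: m_def)
    next
      case False
      then have "gs_count \<sigma> j < gs_count \<sigma> (Suc j)" using sep j by (auto simp: gs_separated_def gs_j0_eq)
      then show ?thesis using gs_count_m[of j] gs_count_m[of "Suc j"] j False by simp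
    qed
  qed
qed

section \<open>The polynomials of the recurrence\<close>

text \<open>The recurrence produces the polynomial of height \<open>hgt k + n\<close> from row \<open>k\<close>; \<open>row y\<close> is that
  row for the index \<open>y\<close>.\<close>

definition row :: "nat \<Rightarrow> nat" where
  "row y = Suc (cP (hgt y - CARD('n)))"

lemma hgt_ge_card: "CARD('n) < y \<Longrightarrow> CARD('n) \<le> hgt y"
  using hgt_less_iff[of y "CARD('n)"] cP_le_card[of "CARD('n)"] by auto

text \<open>Together with \<open>row_U\<close> this makes \<open>row\<close> and \<open>U\<close>
  inverse to each other, so each index beyond n is determined by exactly one row outside
  \<open>m\<close>.\<close>

lemma
  assumes "CARD('n) < y"
  shows hgt_row: "hgt (row y) + CARD('n) = hgt y" and row_less: "row y < y" and U_row: "U (row y) = y"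
proof -
  show *: "hgt (row y) + CARD('n) = hgt y"
    using hgt_ge_card[OF assms] hgt_cP[OF isP_diff[of "hgt y"]] isP_hgt by (simp add: row_def)
  show "row y < y"
  proof -
    have "hgt (row y) < hgt y" using * zero_less_card_finite[where 'a = 'n] by linarith
    then show ?thesis using hgt_less[of "row y" y] assms by (simp add: row_def)
  qed
  show "U (row y) = y"
    using * cP_Suc[of "hgt y"] isP_hgt[of y] cP_hgt[of y] assms by (simp add: U_def)
qed

lemma row_U:
  assumes "k \<ge> 1" "isP (hgt k + CARD('n))"
  shows "row (U k) = k" and "CARD('n) < U k"
proof -
  show "row (U k) = k" using hgt_U[OF assms(2)] cP_hgt[of k] assms(1) by (simp add: row_def)
  show "CARD('n) < U k"
  proof (rule ccontr)
    assume "\<not> CARD('n) < U k"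
    moreover have "1 \<le> U k" by (simp add: U_def cP_Suc assms(2))
    ultimately have "hgt (U k) < CARD('n)" using hgt_le_card[of "U k"] by auto
    then show False using hgt_U[OF assms(2)] by simp
  qed
qed

text \<open>The recurrence in row \<open>row y\<close>, solved for its term of highest index. The
  test \<open>row y < y\<close> serves termination; it holds for all indices beyond n.\<close>

function rp :: "nat \<Rightarrow> 'n vpoly" where
  "rp y = (if y = 0 then 0 else if y \<le> CARD('n) then pp (hgt y) else
     [:of_real (1 / A y (row y)):] *s
       ([:0, 1:] *s (if row y < y then rp (row y) else 0)
         - (\<Sum>i\<in>{1..<y}. [:of_real (A i (row y)):] *s rp i)))"
  by pat_completeness auto
termination by (relation "Wellfounded.measure id") auto

declare rp.simps [simp del]

lemma rp_0: "rp 0 = 0"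
  by (simp add: rp.simps)

lemma rp_rec:
  assumes "CARD('n) < y"
  shows "(\<Sum>i=1..y. [:of_real (A i (row y)):] *s rp i) = [:0, 1:] *s rp (row y)"
proof -
  have a: "A y (row y) \<noteq> 0"
    using A_U_pos[of "row y"] hgt_row[OF assms] isP_hgt[of y] U_row[OF assms] by simp
  have one: "[:complex_of_real (A y (row y)):] * [:complex_of_real (1 / A y (row y)):] = 1"
    using a by (simp add: one_pCons)
  have "rp y = [:of_real (1 / A y (row y)):] *s
      ([:0, 1:] *s rp (row y) - (\<Sum>i\<in>{1..<y}. [:of_real (A i (row y)):] *s rp i))"
    by (subst rp.simps) (use assms row_less[OF assms] in simp)
  then have "[:of_real (A y (row y)):] *s rp y =
      [:0, 1:] *s rp (row y) - (\<Sum>i\<in>{1..<y}. [:of_real (A i (row y)):] *s rp i)"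
    by (simp only: vector_smult_assoc one vector_smult_lid)
  moreover have "{1..y} = insert y {1..<y}" using assms by auto
  then have "(\<Sum>i=1..y. [:of_real (A i (row y)):] *s rp i) =
      [:of_real (A y (row y)):] *s rp y + (\<Sum>i\<in>{1..<y}. [:of_real (A i (row y)):] *s rp i)"
    by simp
  ultimately show ?thesis by simp
qed

text \<open>
  Equality \<open>rp y = pp (hgt y)\<close> fails in general: the Gram-Schmidt polynomials satisfy the
  recurrence only modulo null polynomials.
\<close>

lemma nul_rp_diff: "y \<ge> 1 \<Longrightarrow> nul (rp y - pp (hgt y))"
proof (induction y rule: less_induct)
  case (less y)
  show ?case
  proof (cases "y \<le> CARD('n)")
    case True
    then have "rp y = pp (hgt y)" using less.prems by (simp add: rp.simps)
    then show ?thesis by simp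
  next
    case False
    then have y: "CARD('n) < y" by simp
    let ?k = "row y"
    let ?a = "\<lambda>i. [:complex_of_real (A i ?k):]"
    have a: "A y ?k \<noteq> 0"
      using A_U_pos[of ?k] hgt_row[OF y] isP_hgt[of y] U_row[OF y] by simp
    have k: "?k \<ge> 1" by (simp add: row_def)
    have split: "sum f {1..y} = f y + sum f {1..<y}" for f :: "nat \<Rightarrow> 'n vpoly"
    proof -
      have "{1..y} = insert y {1..<y}" using y by auto
      then show ?thesis by simp
    qed
    have 1: "nul ([:0, 1:] *s (rp ?k - pp (hgt ?k)))"
      using less.IH[OF row_less[OF y] k] by (rule nul_shift)
    have 2: "nul (\<Sum>i\<in>{1..<y}. ?a i *s (rp i - pp (hgt i)))"
      using less.IH by (intro nul_sum nul_smult) auto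
    \<comment> \<open>The exact recurrence for \<open>rp\<close> is compared with the expansion of
      \<open>pp\<close> modulo null polynomials; every term on the right is null.\<close>
    have "?a y *s (rp y - pp (hgt y)) =
      ([:0, 1:] *s pp (hgt ?k) - (\<Sum>i=1..U ?k. ?a i *s pp (hgt i)))
        + [:0, 1:] *s (rp ?k - pp (hgt ?k)) - (\<Sum>i\<in>{1..<y}. ?a i *s (rp i - pp (hgt i)))"
      unfolding U_row[OF y] split
      by (simp only: vector_ssub_ldistrib sum_subtractf rp_rec[OF y, unfolded split, symmetric])
         (simp only: algebra_simps)
    then have "nul (?a y *s (rp y - pp (hgt y)))"
      using nul_diff[OF nul_add[OF expansion[of ?k] 1] 2] by (simp only:)
    then have "nul ([:of_real (1 / A y ?k):] *s (?a y *s (rp y - pp (hgt y))))" by (rule nul_smult)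
    moreover have one: "[:complex_of_real (1 / A y (row y)):] * [:complex_of_real (A y (row y)):] = 1"
      using a by (simp add: one_pCons)
    ultimately show ?thesis by (simp only: vector_smult_assoc one vector_smult_lid)
  qed
qed

lemma ip_rp:
  assumes "k \<ge> 1" "l \<ge> 1"
  shows "ip (rp k) (rp l) = (if k = l then 1 else 0)"
proof -
  have "ip (rp k) (rp l) = ip ((rp k - pp (hgt k)) + pp (hgt k)) ((rp l - pp (hgt l)) + pp (hgt l))"
    by simp
  also have "\<dots> = ip (pp (hgt k)) (pp (hgt l))"
    unfolding ip_add_left ip_add_right
    using nul_rp_diff[OF assms(1)] nul_rp_diff[OF assms(2)] by (simp add: nul_ip_left nul_ip_right)
  finally show ?thesis using assms by (simp add: ip_pp isP_hgt hgt_inj)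
qed

lemma nul_rp_expansion:
  assumes "k \<ge> 1"
  shows "nul ([:0, 1:] *s rp k - (\<Sum>i=1..U k. [:of_real (A i k):] *s rp i))"
proof -
  have 1: "nul ([:0, 1:] *s (rp k - pp (hgt k)))"
    using nul_rp_diff[OF assms] by (rule nul_shift)
  have 2: "nul (\<Sum>i=1..U k. [:of_real (A i k):] *s (rp i - pp (hgt i)))"
    using nul_rp_diff by (intro nul_sum nul_smult) auto
  have "[:0, 1:] *s rp k - (\<Sum>i=1..U k. [:of_real (A i k):] *s rp i) =
    ([:0, 1:] *s pp (hgt k) - (\<Sum>i=1..U k. [:of_real (A i k):] *s pp (hgt i)))
      + [:0, 1:] *s (rp k - pp (hgt k)) - (\<Sum>i=1..U k. [:of_real (A i k):] *s (rp i - pp (hgt i)))"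
    by (simp only: vector_ssub_ldistrib sum_subtractf) (simp only: algebra_simps)
  then show ?thesis using nul_diff[OF nul_add[OF expansion[of k] 1] 2] by (simp only:)
qed

lemma band_sum_rp:
  assumes "k \<ge> 1"
  shows "(\<Sum>i<CARD('n). [:complex_of_real (diag_entry A (CARD('n) - i) (k + i - CARD('n))):] *s rp (k + i - CARD('n)))
      + [:complex_of_real (diag_entry A 0 k):] *s rp k
      + (\<Sum>i=1..CARD('n). [:complex_of_real (diag_entry A i k):] *s rp (k + i))
    = (\<Sum>i=1..U k. [:complex_of_real (A i k):] *s rp i)"
proof -
  have "(\<Sum>i=1..k + CARD('n). [:complex_of_real (A i k):] *s rp i) =
      (\<Sum>i=1..U k. [:complex_of_real (A i k):] *s rp i)"
  proof (rule sum.mono_neutral_right)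
    show "{1..U k} \<subseteq> {1..k + CARD('n)}" using U_eq[OF assms] by auto
    show "\<forall>i\<in>{1..k + CARD('n)} - {1..U k}. [:complex_of_real (A i k):] *s rp i = 0"
      using A_eq_0 by auto
  qed simp
  moreover have band: "A i k = 0" if "i \<ge> 1" "k \<ge> 1" "i > k + CARD('n)" for i k
    using that U_eq[of k] by (intro A_eq_0) simp
  ultimately show ?thesis
    using band_sum[where A = A and p = rp, OF A_sym band rp_0 assms] by simp
qed

text \<open>In row \<open>m j\<close> the last index is \<open>m j + n - j\<close>, so the terms
  beyond the truncated sum vanish and \<open>q_poly\<close> is the full defect of the recurrence in
  that row.\<close>

lemma q_poly_rp:
  assumes "j \<in> {1..card Qs}"
  shows "q_poly A m rp j = [:0, 1:] *s rp (m j) - (\<Sum>i=1..U (m j). [:of_real (A i (m j)):] *s rp i)"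
proof -
  let ?k = "m j" and ?n = "CARD('n)"
  let ?d = "\<lambda>i k. [:complex_of_real (diag_entry A i k):]"
  have k: "?k \<ge> 1" using assms m_ge_1[of j] by auto
  have "cQ (Suc (hgt ?k + ?n)) = j"
    using assms k m_less_iff[of j "Suc j"] by (intro cQ_between) auto
  then have U: "U ?k + j = ?k + ?n" using U_eq[OF k] by simp
  have "(\<Sum>i=1..?n. ?d i ?k *s rp (?k + i)) = (\<Sum>i=1..?n - j. ?d i ?k *s rp (?k + i))"
  proof (rule sum.mono_neutral_right)
    show "\<forall>i\<in>{1..?n} - {1..?n - j}. ?d i ?k *s rp (?k + i) = 0"
      using U by (auto simp: diag_entry_def A_sym[of ?k] A_eq_0)
  qed auto
  then show ?thesis
    unfolding band_sum_rp[OF k, symmetric] q_poly_def Let_def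
    by (simp only: vector_sub_rdistrib) (simp only: algebra_simps)
qed

lemma recurrence_polys_rp: "\<exists>T. admissible_triangular T \<and> recurrence_polys A (card Qs) m T rp"
proof -
  let ?n = "CARD('n)"
  \<comment> \<open>Column \<open>j\<close> holds the coefficients of \<open>pp (pos j)\<close>,
    which is constant because its height is below n. The height bound makes \<open>T\<close>
    triangular, and the diagonal entries are reciprocals of norms.\<close>
  define T where "T = (\<chi> (i::'n) (j::'n). Re (cf (pp (pos j)) (pos i)))"
  have T: "of_real (T $ i $ j) = cf (pp (pos j)) (pos i)" for i j
    by (simp add: T_def of_real_Re[OF cf_real[OF real_vp_pp]])
  have "T $ i $ j = 0" if "j < i" for i j
    using that hlt_pp[of "pos j"] by (simp add: T_def hlt_def Suc_le_eq pos_less_iff)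
  moreover have "T $ i $ i \<noteq> 0" for i
    using nrm_pos[OF isP_less_card[OF pos_less_card[of i]]] by (simp add: T_def cf_pp)
  ultimately have "admissible_triangular T" by (simp add: admissible_triangular_def)
  moreover have "rp k = (\<chi> i j. [:complex_of_real (T $ i $ j):]) *v unit_vp k" if k: "k \<in> {1..?n}" for k
  proof -
    have "k - 1 \<in> range (pos :: 'n \<Rightarrow> nat)" using k by (auto simp: range_pos)
    then obtain j :: 'n where j: "k - 1 = pos j" by auto
    have unit: "unit_vp k = (axis j 1 :: 'n vpoly)"
      using k j pos_less_card[of j] inj_eq[OF inj_pos, of j] by (auto simp: vec_eq_iff axis_def unit_vp_def)
    have rp: "rp k = pp (pos j)"
      using k hgt_le_card[OF k] j by (simp add: rp.simps)
    show ?thesis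
      unfolding vec_eq_iff
    proof
      fix i
      have "pp (pos j) $ i = [:of_real (T $ i $ j):]"
      proof (rule poly_eqI)
        fix d
        show "coeff (pp (pos j) $ i) d = coeff [:of_real (T $ i $ j):] d"
        proof (cases "d = 0")
          case True
          then show ?thesis using cf_pos[of "pp (pos j)" 0 i] by (simp add: T)
        next
          case False
          then have "?n \<le> ?n * d" by simp
          then have "Suc (pos j) \<le> ?n * d + pos i" using pos_less_card[of j] by linarith
          then have "cf (pp (pos j)) (?n * d + pos i) = 0"
            using hlt_pp[of "pos j"] unfolding hlt_def by blast
          then show ?thesis using False by (simp add: cf_pos coeff_pCons split: nat.split)
        qed
      qed
      then show "rp k $ i = ((\<chi> i j. [:complex_of_real (T $ i $ j):]) *v unit_vp k) $ i"
        unfolding rp unit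
        by (simp add: matrix_vector_mult_def axis_def if_distrib[of "\<lambda>z. _ * z"] cong: if_cong)
    qed
  qed
  moreover have "(\<Sum>i=1..U k. [:complex_of_real (A i k):] *s rp i) = [:0, 1:] *s rp k"
    if "k \<ge> 1" "k \<notin> m ` {1..card Qs}" for k
    using rp_rec[OF row_U(2)[of k]] row_U(1)[of k] that isP_iff_m[of k] by simp
  ultimately show ?thesis
    unfolding recurrence_polys_def Let_def using rp_0 band_sum_rp
    by (intro exI[of _ T] conjI ballI allI impI) auto
qed

section \<open>The spectral property and the identification of the coefficients\<close>

lemma spectral_at_A: "spectral_at \<sigma> A (card Qs) m"
proof -
  obtain T where T: "admissible_triangular T" "recurrence_polys A (card Qs) m T rp"
    using recurrence_polys_rp by blast
  have "L2_norm \<sigma> (vp_fun (q_poly A m rp j)) = 0" if "j \<in> {1..card Qs}" for j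
    unfolding L2_norm_eq_0_iff q_poly_rp[OF that] using that
    by (intro nul_rp_expansion m_ge_1) simp
  then show ?thesis
    using sigma T ip_rp vp_fun_in_L2_space unfolding spectral_at_def sigma_class_def ip_def
    by blast
qed

text \<open>Pairing with the orthonormal polynomial of index \<open>i\<close> kills the null part
  and isolates \<open>c i\<close>; beyond \<open>l\<close> both sides are 0.\<close>

lemma expansion_coefficient:
  assumes "k \<ge> 1" "i \<ge> 1"
    and exp: "[:0, 1:] *s gs_p \<sigma> k =
      (\<Sum>i=1..l. [:c i:] *s gs_p \<sigma> i) + (\<Sum>j=1..gs_j0 \<sigma>. R j *s gs_q \<sigma> j)"
    and zero: "\<And>i. i > l \<Longrightarrow> c i = 0"
  shows "c i = of_real (A i k)"
proof -
  have nul: "nul (\<Sum>j=1..gs_j0 \<sigma>. R j *s gs_q \<sigma> j)"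
    by (intro nul_sum nul_poly_smult nul_gs_q) auto
  have "of_real (A i k) = (\<Sum>i'=1..l. c i' * ip (pp (hgt i)) (gs_p \<sigma> i'))"
    unfolding of_real_A gs_p_eq[OF assms(1), symmetric] exp ip_add_right nul_ip_right[OF nul]
    by (simp add: ip_sum_right ip_smult_right)
  also have "\<dots> = (\<Sum>i'=1..l. if i' = i then c i' else 0)"
    using assms(2) by (intro sum.cong) (auto simp: gs_p_eq ip_pp isP_hgt hgt_inj)
  also have "\<dots> = c i" using assms(2) zero[of i] by (auto simp: not_le)
  finally show ?thesis by simp
qed

end

theorem theorem5p1:
  fixes \<sigma> :: "('n::{finite,wellorder}) matfun"
    and c :: "nat \<Rightarrow> nat \<Rightarrow> complex"
    and R :: "nat \<Rightarrow> nat \<Rightarrow> complex poly"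
    and l :: "nat \<Rightarrow> nat"
  assumes "\<sigma> \<in> sigma_class"
    and "\<And>k. k \<ge> 1 \<Longrightarrow>
           [:0, 1:] *s gs_p \<sigma> k =
             (\<Sum>i=1..l k. [:c i k:] *s gs_p \<sigma> i) + (\<Sum>j=1..gs_j0 \<sigma>. R k j *s gs_q \<sigma> j)"
    and "\<And>i k. k \<ge> 1 \<Longrightarrow> i > l k \<Longrightarrow> c i k = 0"
  shows "\<exists>A :: nat \<Rightarrow> nat \<Rightarrow> real.
           (\<forall>k\<ge>1. \<forall>j\<ge>1. c k j = complex_of_real (A k j)) \<and>
           spectral_function_wide \<sigma> A \<and>
           (spectral_function \<sigma> A \<longleftrightarrow> gs_separated \<sigma>)"
proof -
  interpret sigma_matfun \<sigma> by unfold_locales (rule assms(1))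
  note deg = degeneration_indices_A
  \<comment> \<open>The indices are unique, so any separated choice of them shows that
    \<open>m\<close> is separated.\<close>
  have "separated_indices (card Qs) m"
    if "degeneration_indices CARD('n) A j0 m'" "separated_indices j0 m'" for j0 m'
    using degeneration_indices_unique[OF deg that(1)] that(2) by (simp add: separated_indices_def)
  then have "spectral_function \<sigma> A \<longleftrightarrow> gs_separated \<sigma>"
    unfolding spectral_function_def band_class_def separated_iff[symmetric]
    using deg spectral_at_A by blast
  moreover have "spectral_function_wide \<sigma> A"
    unfolding spectral_function_wide_def using deg spectral_at_A by blast
  moreover have "\<forall>k\<ge>1. \<forall>j\<ge>1. c k j = complex_of_real (A k j)"
    using assms(2,3) by (intro allI impI expansion_coefficient[where l = "l j" and R = "R j" for j]) auto
  ultimately show ?thesis by blast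
qed

end
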